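(* Let $\rho,\gamma\in\mathrm{Aut}(\mathbb{Q},<)$. The following are equivalent: (1) $\gamma\in\mathcal{C}_\rho$; (2) for every finite $A\subseteq\mathbb{Q}$, putting $p=\gamma\restriction A$, there is a $\wp$-homomorphism $\phi:(A/\sim_p,\prec,\wp_p)\to(\mathcal{O}_\rho,\prec,\wp_\rho)$; (3) $\mathcal{O}_\rho$ is of type $\infty_{+,-,0}$, or both $\mathcal{O}_\gamma$ and $\mathcal{O}_\rho$ are not of type $\infty_{+,-,0}$ and there is a $\chi$-homomorphism from the canonical $\chi$-colored ordering $(\mathcal{L}_\gamma,\prec,\hat\wp_\gamma)$ of $(\mathcal{O}_\gamma,\prec,\wp_\gamma)$ to the canonical $\chi$-colored ordering $(\mathcal{L}_\rho,\prec,\hat\wp_\rho)$ of $(\mathcal{O}_\rho,\prec,\wp_\rho)$.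
   Context: $\mathrm{Aut}(\mathbb{Q},<)$ carries the topology of pointwise convergence; $\mathcal{C}_\rho$ is the topological closure of $\{\sigma\rho\sigma^{-1}:\sigma\in\mathrm{Aut}(\mathbb{Q},<)\}$. Orbitals: for $\gamma$ and $x\in\mathbb{Q}$ the orbital of $\gamma$ containing $x$ is $\{q:\exists m,n\in\mathbb{Z},\ \gamma^n(x)\le q\le\gamma^m(x)\}$; the parity $\wp_\gamma(x)$ is $+,0,-$ according as $\gamma(x)>x$, $=x$, $<x$ (constant on orbitals). $\mathcal{O}_\gamma$ is the set of orbitals, ordered by $I\prec J$ iff $a<b$ for all $a\in I,b\in J$, and colored by parity. Partial orbitals: for a finite partial isomorphism $p$ of $(\mathbb{Q},<)$ and $a\in\mathrm{Dom}(p)\cup\mathrm{Rng}(p)$, $\wp_p(a)$ is the sign of $p(a)-a$ (if $a\in\mathrm{Dom}(p)$) or of $a-p^{-1}(a)$ (if $a\in\mathrm{Rng}(p)$). Elements $a,b\in\mathbb{Q}$ are $p$-related if $a=b$, or if $\wp_p(a)=+$ or $\wp_p(b)=+$ and one of $a\le b\le p(a)$, $b\le a\le p(b)$, $p^{-1}(a)\le b\le a$, $p^{-1}(b)\le a\le b$ holds, or if $\wp_p(a)=-$ or $\wp_p(b)=-$ and one of $a\le b\le p^{-1}(a)$, $b\le a\le p^{-1}(b)$, $p(a)\le b\le a$, $p(b)\le a\le b$ holds (whenever the values are defined). $\sim_p$ is the equivalence relation generated by $p$-relatedness; for $A\subseteq\mathbb{Q}$, $A/\sim_p$ is the set of $\sim_p$-classes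 of elements of $A$, ordered by $\prec$ and colored by $\wp_p$. A $\wp$-homomorphism (= $\kappa$-homomorphism) between $\{+,-,0\}$-colored linear orderings is a color-preserving map $\phi$ with $x\le y\Rightarrow\phi(x)\le\phi(y)$ that is injective on elements of color $0$. Types: for a $\{+,-,0\}$-colored linear order $(L,\le,\kappa)$ and convex $L_0\subseteq L$: type $\infty_{+,-,0}$ means for every $n$ there are $a_1<\dots<a_{3(n+1)}$ in $L_0$ with colors cycling $+,-,0$; type $\varepsilon\in\{+,-,0\}$ means $\kappa(L_0)=\{\varepsilon\}$ and, for $\varepsilon=0$, $|L_0|=1$; type $\infty_0$ means $L_0$ infinite of constant color $0$; type $\infty_{\varepsilon_1\varepsilon_2}$ ($\varepsilon_1\varepsilon_2\in\{+-,+0,-0\}$) means $\kappa(L_0)=\{\varepsilon_1,\varepsilon_2\}$ and for every $n$ there are $a_1<\dots<a_{2(n+1)}$ in $L_0$ alternating $\varepsilon_1,\varepsilon_2$. $\chi=\{\{+\},\{-\},\{0\},\infty_0,\infty_{+-},\infty_{+0},\infty_{-0}\}$, partially ordered by $\subseteq$ generated by $\{\varepsilon\}\subseteq\infty_{\varepsilon_1\varepsilon_2}$ for $\varepsilon\in\{\varepsilon_1,\varepsilon_2\}$, $\{0\}\subseteq\infty_0\subseteq\infty_{+0}$, $\infty_0\subseteq\infty_{-0}$. A decomposition of $L$ into finitely many intervals $L_1\prec\dots\prec L_n$ of types among $+,-,0,\infty_0,\infty_{+-},\infty_{+0},\infty_{-0}$ yields the $\chi$-colored ordering $(\{L_i\},\prec,\hat\kappa)$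 with $\hat\kappa(L_i)=\{\tau\}$ for type $\tau\in\{+,-,0\}$ and $\hat\kappa(L_i)=\tau$ otherwise. A finite $\chi$-colored ordering is canonical if for all $x,y$: (1) $x\ne y$ and $\hat\kappa(x)\subseteq\hat\kappa(y)$ imply some element lies strictly between them; (2) if some element lies strictly between $x,y$ and $\hat\kappa(x)=\infty_{\varepsilon_1\varepsilon_2}$, $\hat\kappa(y)=\infty_{\varepsilon_1'\varepsilon_2'}$ with $\varepsilon_1\varepsilon_2\ne\varepsilon'_1\varepsilon'_2$, then (a) there are $z_1,z_2$ with $x<z_1<z_2<y$ or $y<z_1<z_2<x$ and $\hat\kappa(z_1)\ne\hat\kappa(z_2)$ both in $\{\{+\},\{-\},\{0\},\infty_0,\infty_{\varepsilon_1\varepsilon_2},\infty_{\varepsilon'_1\varepsilon'_2}\}$, or (b) some $z$ strictly between $x,y$ has $\hat\kappa(z)=\infty_{\varepsilon\varepsilon'}$ with $\{\varepsilon\}\not\subseteq\hat\kappa(x)$, $\{\varepsilon'\}\not\subseteq\hat\kappa(y)$. For $L$ not of type $\infty_{+,-,0}$ a decomposition with canonical associated $\chi$-colored ordering exists and this ordering is unique up to isomorphism; it is the canonical $\chi$-colored ordering of $L$. A $\chi$-homomorphism $\phi:(\mathcal{L},<,\hat\kappa)\to(\mathcal{L}',<',\hat\kappa')$ satisfies $x_1\le x_2\Rightarrow\phi(x_1)\le'\phi(x_2)$ and $\hat\kappa(x)\subseteq\hat\kappa'(\phi(x))$. *)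

theory Defs
  imports "HOL-Analysis.Analysis"
begin

definition aut :: "(rat \<Rightarrow> rat) \<Rightarrow> bool" where
  "aut f \<longleftrightarrow> bij f \<and> strict_mono f"

definition ptw_top :: "(rat \<Rightarrow> rat) topology" where
  "ptw_top = subtopology (product_topology (\<lambda>_. discrete_topology (UNIV :: rat set)) UNIV) {f. aut f}"

definition conj_closure :: "(rat \<Rightarrow> rat) \<Rightarrow> (rat \<Rightarrow> rat) set" where
  "conj_closure rho = ptw_top closure_of {sigma \<circ> rho \<circ> inv sigma | sigma. aut sigma}"

definition ipow :: "(rat \<Rightarrow> rat) \<Rightarrow> int \<Rightarrow> rat \<Rightarrow> rat" where
  "ipow g n = (if 0 \<le> n then g ^^ nat n else inv g ^^ nat (- n))"

definition orbital :: "(rat \<Rightarrow> rat) \<Rightarrow> rat \<Rightarrow> rat set" where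
  "orbital g x = {q. \<exists>m n :: int. ipow g n x \<le> q \<and> q \<le> ipow g m x}"

datatype color = Pos | Neg | Zero

definition sgnc :: "rat \<Rightarrow> color" where
  "sgnc r = (if r > 0 then Pos else if r = 0 then Zero else Neg)"

definition par :: "(rat \<Rightarrow> rat) \<Rightarrow> rat \<Rightarrow> color" where
  "par g x = sgnc (g x - x)"

definition orbitals :: "(rat \<Rightarrow> rat) \<Rightarrow> rat set set" where
  "orbitals g = range (orbital g)"

definition setlt :: "('a \<Rightarrow> 'a \<Rightarrow> bool) \<Rightarrow> 'a set \<Rightarrow> 'a set \<Rightarrow> bool" where
  "setlt lt X Y \<longleftrightarrow> (\<forall>x\<in>X. \<forall>y\<in>Y. lt x y)"

abbreviation prec :: "rat set \<Rightarrow> rat set \<Rightarrow> bool" where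
  "prec \<equiv> setlt (<)"

text \<open>Colour of an orbital (parity is constant on orbitals).\<close>
definition orbcol :: "(rat \<Rightarrow> rat) \<Rightarrow> rat set \<Rightarrow> color" where
  "orbcol g I = par g (SOME x. x \<in> I)"

definition restr :: "(rat \<Rightarrow> rat) \<Rightarrow> rat set \<Rightarrow> (rat \<rightharpoonup> rat)" where
  "restr g A = (Some \<circ> g) |` A"

definition pinv :: "(rat \<rightharpoonup> rat) \<Rightarrow> rat \<Rightarrow> rat option" where
  "pinv p a = (if a \<in> ran p then Some (THE x. p x = Some a) else None)"

definition ppar :: "(rat \<rightharpoonup> rat) \<Rightarrow> rat \<Rightarrow> color option" where
  "ppar p a = (case p a of Some b \<Rightarrow> Some (sgnc (b - a))
                | None \<Rightarrow> map_option (\<lambda>c. sgnc (a - c)) (pinv p a))"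

definition prel :: "(rat \<rightharpoonup> rat) \<Rightarrow> rat \<Rightarrow> rat \<Rightarrow> bool" where
  "prel p a b \<longleftrightarrow> a = b \<or>
    ((ppar p a = Some Pos \<or> ppar p b = Some Pos) \<and>
      ((\<exists>c. p a = Some c \<and> a \<le> b \<and> b \<le> c) \<or> (\<exists>c. p b = Some c \<and> b \<le> a \<and> a \<le> c) \<or>
       (\<exists>c. pinv p a = Some c \<and> c \<le> b \<and> b \<le> a) \<or> (\<exists>c. pinv p b = Some c \<and> c \<le> a \<and> a \<le> b))) \<or>
    ((ppar p a = Some Neg \<or> ppar p b = Some Neg) \<and>
      ((\<exists>c. pinv p a = Some c \<and> a \<le> b \<and> b \<le> c) \<or> (\<exists>c. pinv p b = Some c \<and> b \<le> a \<and> a \<le> c) \<or>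
       (\<exists>c. p a = Some c \<and> c \<le> b \<and> b \<le> a) \<or> (\<exists>c. p b = Some c \<and> c \<le> a \<and> a \<le> b)))"

definition psim :: "(rat \<rightharpoonup> rat) \<Rightarrow> rat \<Rightarrow> rat \<Rightarrow> bool" where
  "psim p = (\<lambda>a b. prel p a b \<or> prel p b a)\<^sup>*\<^sup>*"

definition pclasses :: "(rat \<rightharpoonup> rat) \<Rightarrow> rat set \<Rightarrow> rat set set" where
  "pclasses p A = {{b. psim p a b} | a. a \<in> A}"

definition pclcol :: "(rat \<rightharpoonup> rat) \<Rightarrow> rat set \<Rightarrow> rat set \<Rightarrow> color" where
  "pclcol p A C = the (ppar p (SOME a. a \<in> A \<and> a \<in> C))"

definition lew :: "('a \<Rightarrow> 'a \<Rightarrow> bool) \<Rightarrow> 'a \<Rightarrow> 'a \<Rightarrow> bool" where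
  "lew lt x y \<longleftrightarrow> lt x y \<or> x = y"

definition wp_hom :: "'a set \<Rightarrow> ('a \<Rightarrow> 'a \<Rightarrow> bool) \<Rightarrow> ('a \<Rightarrow> color)
    \<Rightarrow> 'b set \<Rightarrow> ('b \<Rightarrow> 'b \<Rightarrow> bool) \<Rightarrow> ('b \<Rightarrow> color) \<Rightarrow> ('a \<Rightarrow> 'b) \<Rightarrow> bool" where
  "wp_hom L lt k L' lt' k' phi \<longleftrightarrow>
     (\<forall>x\<in>L. phi x \<in> L' \<and> k' (phi x) = k x) \<and>
     (\<forall>x\<in>L. \<forall>y\<in>L. lew lt x y \<longrightarrow> lew lt' (phi x) (phi y)) \<and>
     inj_on phi {x\<in>L. k x = Zero}"

definition cyc3 :: "nat \<Rightarrow> color" where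
  "cyc3 i = (if i mod 3 = 0 then Pos else if i mod 3 = 1 then Neg else Zero)"

definition type_inf3 :: "('a \<Rightarrow> 'a \<Rightarrow> bool) \<Rightarrow> ('a \<Rightarrow> color) \<Rightarrow> 'a set \<Rightarrow> bool" where
  "type_inf3 lt k L0 \<longleftrightarrow> (\<forall>n. \<exists>a :: nat \<Rightarrow> 'a.
      (\<forall>i < 3 * (n + 1). a i \<in> L0 \<and> k (a i) = cyc3 i) \<and>
      (\<forall>i j. i < j \<and> j < 3 * (n + 1) \<longrightarrow> lt (a i) (a j)))"

definition type_alt :: "('a \<Rightarrow> 'a \<Rightarrow> bool) \<Rightarrow> ('a \<Rightarrow> color) \<Rightarrow> 'a set \<Rightarrow> color \<Rightarrow> color \<Rightarrow> bool" where
  "type_alt lt k L0 e1 e2 \<longleftrightarrow> k ` L0 = {e1, e2} \<and> (\<forall>n. \<exists>a :: nat \<Rightarrow> 'a.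
      (\<forall>i < 2 * (n + 1). a i \<in> L0 \<and> k (a i) = (if even i then e1 else e2)) \<and>
      (\<forall>i j. i < j \<and> j < 2 * (n + 1) \<longrightarrow> lt (a i) (a j)))"

text \<open>The set chi: S e stands for {e}; I0 = inf_0; IPM = inf_{+-}; IPZ = inf_{+0}; IMZ = inf_{-0}.\<close>
datatype chi = S color | I0 | IPM | IPZ | IMZ

definition has_chi_type :: "('a \<Rightarrow> 'a \<Rightarrow> bool) \<Rightarrow> ('a \<Rightarrow> color) \<Rightarrow> 'a set \<Rightarrow> chi \<Rightarrow> bool" where
  "has_chi_type lt k L0 t = (case t of
      S e \<Rightarrow> k ` L0 = {e} \<and> (e = Zero \<longrightarrow> card L0 = 1)
    | I0 \<Rightarrow> infinite L0 \<and> k ` L0 = {Zero}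
    | IPM \<Rightarrow> type_alt lt k L0 Pos Neg
    | IPZ \<Rightarrow> type_alt lt k L0 Pos Zero
    | IMZ \<Rightarrow> type_alt lt k L0 Neg Zero)"

text \<open>The partial order on chi (reflexive-transitive closure of the generating relations, written out).\<close>
definition chi_le :: "chi \<Rightarrow> chi \<Rightarrow> bool" where
  "chi_le x y \<longleftrightarrow> x = y \<or> (x, y) \<in> {(S Pos, IPM), (S Neg, IPM), (S Pos, IPZ), (S Zero, IPZ),
      (S Neg, IMZ), (S Zero, IMZ), (S Zero, I0), (I0, IPZ), (I0, IMZ)}"

definition inf2 :: "color \<Rightarrow> color \<Rightarrow> chi" where
  "inf2 a b = (if {a, b} = {Pos, Neg} then IPM else if {a, b} = {Pos, Zero} then IPZ else IMZ)"

definition betw :: "('a \<Rightarrow> 'a \<Rightarrow> bool) \<Rightarrow> 'a \<Rightarrow> 'a \<Rightarrow> 'a \<Rightarrow> bool" where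
  "betw lt x y z \<longleftrightarrow> (lt x z \<and> lt z y) \<or> (lt y z \<and> lt z x)"

definition canonical :: "'a set \<Rightarrow> ('a \<Rightarrow> 'a \<Rightarrow> bool) \<Rightarrow> ('a \<Rightarrow> chi) \<Rightarrow> bool" where
  "canonical D lt c \<longleftrightarrow> finite D \<and>
    (\<forall>x\<in>D. \<forall>y\<in>D. x \<noteq> y \<and> chi_le (c x) (c y) \<longrightarrow> (\<exists>z\<in>D. betw lt x y z)) \<and>
    (\<forall>x\<in>D. \<forall>y\<in>D. (\<exists>z\<in>D. betw lt x y z) \<and> c x \<in> {IPM, IPZ, IMZ} \<and> c y \<in> {IPM, IPZ, IMZ}
        \<and> c x \<noteq> c y \<longrightarrow>
      (\<exists>z1\<in>D. \<exists>z2\<in>D. ((lt x z1 \<and> lt z1 z2 \<and> lt z2 y) \<or> (lt y z1 \<and> lt z1 z2 \<and> lt z2 x))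
          \<and> c z1 \<noteq> c z2
          \<and> c z1 \<in> {S Pos, S Neg, S Zero, I0, c x, c y}
          \<and> c z2 \<in> {S Pos, S Neg, S Zero, I0, c x, c y}) \<or>
      (\<exists>z\<in>D. betw lt x y z \<and> (\<exists>e e'. e \<noteq> e' \<and> c z = inf2 e e'
          \<and> \<not> chi_le (S e) (c x) \<and> \<not> chi_le (S e') (c y))))"

definition convex_in :: "'a set \<Rightarrow> ('a \<Rightarrow> 'a \<Rightarrow> bool) \<Rightarrow> 'a set \<Rightarrow> bool" where
  "convex_in L lt I \<longleftrightarrow> I \<subseteq> L \<and> (\<forall>x\<in>I. \<forall>y\<in>I. \<forall>z\<in>L. lt x z \<and> lt z y \<longrightarrow> z \<in> I)"

text \<open>A decomposition of L into finitely many nonempty disjoint intervals, each with its type;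
  the associated chi-coloured ordering is (D, setlt lt, c).\<close>
definition is_decomp :: "'a set \<Rightarrow> ('a \<Rightarrow> 'a \<Rightarrow> bool) \<Rightarrow> ('a \<Rightarrow> color) \<Rightarrow> 'a set set \<Rightarrow> ('a set \<Rightarrow> chi) \<Rightarrow> bool" where
  "is_decomp L lt k D c \<longleftrightarrow> finite D \<and> \<Union>D = L \<and>
     (\<forall>I\<in>D. I \<noteq> {} \<and> convex_in L lt I \<and> has_chi_type lt k I (c I)) \<and>
     (\<forall>I\<in>D. \<forall>J\<in>D. I \<noteq> J \<longrightarrow> I \<inter> J = {})"

definition canonical_decomp :: "'a set \<Rightarrow> ('a \<Rightarrow> 'a \<Rightarrow> bool) \<Rightarrow> ('a \<Rightarrow> color) \<Rightarrow> 'a set set \<Rightarrow> ('a set \<Rightarrow> chi) \<Rightarrow> bool" where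
  "canonical_decomp L lt k D c \<longleftrightarrow> is_decomp L lt k D c \<and> canonical D (setlt lt) c"

definition chi_hom :: "'a set \<Rightarrow> ('a \<Rightarrow> 'a \<Rightarrow> bool) \<Rightarrow> ('a \<Rightarrow> chi)
    \<Rightarrow> 'b set \<Rightarrow> ('b \<Rightarrow> 'b \<Rightarrow> bool) \<Rightarrow> ('b \<Rightarrow> chi) \<Rightarrow> ('a \<Rightarrow> 'b) \<Rightarrow> bool" where
  "chi_hom D lt c D' lt' c' phi \<longleftrightarrow>
     (\<forall>x\<in>D. phi x \<in> D' \<and> chi_le (c x) (c' (phi x))) \<and>
     (\<forall>x\<in>D. \<forall>y\<in>D. lew lt x y \<longrightarrow> lew lt' (phi x) (phi y))"

end

theory Submission
  imports Defs
begin

text \<open>All three conditions are equivalent to: every finite set of orbitals of \<open>\<gamma>\<close> has a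
  \<open>\<wp>\<close>-homomorphism into the orbitals of \<open>\<rho>\<close>.

  For (1) and (2), \<open>\<gamma>\<close> lies in the closure iff for each finite \<open>A\<close> there is an increasing \<open>t\<close> on
  \<open>A \<union> \<gamma>(A)\<close> with \<open>t \<circ> \<gamma> = \<rho> \<circ> t\<close> on \<open>A\<close>. Given a \<open>\<wp>\<close>-homomorphism as in (2), such a \<open>t\<close> is
  built by adding the elements of \<open>A\<close> in increasing order: the larger of \<open>a\<close>, \<open>\<gamma>(a)\<close> then exceeds
  everything treated before, so only the smaller one has to be fitted into a gap.

  For (3), cut a colored order without long \<open>+-0\<close> cycles greedily into intervals; a decomposition with
  the least number of intervals is canonical. A \<open>\<chi>\<close>-homomorphism yields finite homomorphisms
  interval by interval; conversely, a homomorphism of a finite set that meets each interval in a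
  sufficiently long alternating sequence determines a \<open>\<chi>\<close>-homomorphism by the pigeonhole principle.\<close>

section \<open>Decompositions of colored linear orders\<close>

text \<open>Finite data decide everything: a basic neighborhood of \<gamma> prescribes finitely many
  values, and an infinite type is witnessed by finite sequences of every length. The one rigid
  feature is color 0. An orbital of color + or - has no endpoints and \<rho> moves every point of
  it, so finitely many points always fit into it, while a fixed point offers room for one. Hence
  injectivity is demanded at color 0 alone, the types {0} and infinity_0 are kept apart, and two
  neighboring intervals of comparable types can be merged unless both are single fixed points. Such
  neighbors never occur among orbitals, since the midpoint of two fixed points lies in a third
  orbital; this is why a decomposition with fewest intervals satisfies condition (1) of
  canonicity.\<close>

locale strict_lin =
  fixes L :: "'a set" and lt :: "'a \<Rightarrow> 'a \<Rightarrow> bool"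
  assumes irrefl: "x \<in> L \<Longrightarrow> \<not> lt x x"
    and trans: "x \<in> L \<Longrightarrow> y \<in> L \<Longrightarrow> z \<in> L \<Longrightarrow> lt x y \<Longrightarrow> lt y z \<Longrightarrow> lt x z"
    and total: "x \<in> L \<Longrightarrow> y \<in> L \<Longrightarrow> x \<noteq> y \<Longrightarrow> lt x y \<or> lt y x"

lemma (in strict_lin) asym: "x \<in> L \<Longrightarrow> y \<in> L \<Longrightarrow> lt x y \<Longrightarrow> \<not> lt y x"
  using irrefl trans by blast

text \<open>The color word is a parameter so that the same cutting and embedding arguments serve the
  cyclic word \<open>cyc3\<close>, the alternating words and the constant ones.\<close>

definition color_chain :: "('a \<Rightarrow> 'a \<Rightarrow> bool) \<Rightarrow> ('a \<Rightarrow> color) \<Rightarrow> 'a set \<Rightarrow> (nat \<Rightarrow> color) \<Rightarrow> nat \<Rightarrow> bool" where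
  "color_chain lt k X c n \<longleftrightarrow> (\<exists>a :: nat \<Rightarrow> 'a. (\<forall>i < n. a i \<in> X \<and> k (a i) = c i) \<and>
      (\<forall>i j. i < j \<and> j < n \<longrightarrow> lt (a i) (a j)))"

definition alt2 :: "color \<Rightarrow> color \<Rightarrow> nat \<Rightarrow> color" where
  "alt2 e1 e2 i = (if even i then e1 else e2)"

lemma type_inf3_iff_chain:
  "type_inf3 lt k X \<longleftrightarrow> (\<forall>n. color_chain lt k X cyc3 (3 * (n + 1)))"
  unfolding type_inf3_def color_chain_def ..

lemma type_alt_iff_chain:
  "type_alt lt k X e1 e2 \<longleftrightarrow> k ` X = {e1, e2} \<and> (\<forall>n. color_chain lt k X (alt2 e1 e2) (2 * (n + 1)))"
  unfolding type_alt_def color_chain_def alt2_def ..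

lemma color_chain_mono:
  assumes "color_chain lt k X c n" "X \<subseteq> Y"
  shows "color_chain lt k Y c n"
  using assms unfolding color_chain_def by blast

lemma color_chain_0 [simp]: "color_chain lt k X c 0"
  unfolding color_chain_def by simp

lemma color_chain_Suc:
  assumes "color_chain lt k X c n" "y \<in> Y" "X \<subseteq> Y" "k y = c n" "\<And>x. x \<in> X \<Longrightarrow> lt x y"
  shows "color_chain lt k Y c (Suc n)"
proof -
  obtain a where a: "\<forall>i < n. a i \<in> X \<and> k (a i) = c i" "\<forall>i j. i < j \<and> j < n \<longrightarrow> lt (a i) (a j)"
    using assms(1) unfolding color_chain_def by blast
  show ?thesis unfolding color_chain_def
    by (rule exI[of _ "a(n := y)"]) (use a assms in \<open>auto simp: less_Suc_eq\<close>)
qed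

lemma image_two_colors:
  assumes "e \<notin> k ` Y"
  shows "k ` Y \<subseteq> {Pos, Neg} \<or> k ` Y \<subseteq> {Pos, Zero} \<or> k ` Y \<subseteq> {Neg, Zero}"
proof -
  have "x \<in> {Pos, Neg, Zero} - {e}" if "x \<in> k ` Y" for x
    using that assms by (cases x) auto
  then have "k ` Y \<subseteq> {Pos, Neg, Zero} - {e}" by (rule subsetI)
  then show ?thesis by (cases e) (simp_all add: insert_Diff_if)
qed

context strict_lin
begin

text \<open>Intervals are convex in \<open>L\<close>, not merely in \<open>X\<close>, so
  decompositions of disjoint pieces can be united without any order between the pieces.\<close>

definition decomposable :: "('a \<Rightarrow> color) \<Rightarrow> 'a set \<Rightarrow> bool" where
  "decomposable k X \<longleftrightarrow> (\<exists>D. finite D \<and> \<Union>D = X \<and>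
     (\<forall>I\<in>D. I \<noteq> {} \<and> convex_in L lt I \<and> (\<exists>t. has_chi_type lt k I t)) \<and>
     (\<forall>I\<in>D. \<forall>J\<in>D. I \<noteq> J \<longrightarrow> I \<inter> J = {}))"

lemma decomposable_empty: "decomposable k {}"
  unfolding decomposable_def by (rule exI[of _ "{}"]) simp

lemma decomposable_typed:
  assumes "convex_in L lt X" "has_chi_type lt k X t" "X \<noteq> {}"
  shows "decomposable k X"
  unfolding decomposable_def by (rule exI[of _ "{X}"]) (use assms in auto)

lemma decomposable_Un:
  assumes "decomposable k X" "decomposable k Y" "X \<inter> Y = {}"
  shows "decomposable k (X \<union> Y)"
proof -
  obtain D where D: "finite D" "\<Union>D = X"
     "\<forall>I\<in>D. I \<noteq> {} \<and> convex_in L lt I \<and> (\<exists>t. has_chi_type lt k I t)"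
     "\<forall>I\<in>D. \<forall>J\<in>D. I \<noteq> J \<longrightarrow> I \<inter> J = {}"
    using assms(1) unfolding decomposable_def by blast
  obtain E where E: "finite E" "\<Union>E = Y"
     "\<forall>I\<in>E. I \<noteq> {} \<and> convex_in L lt I \<and> (\<exists>t. has_chi_type lt k I t)"
     "\<forall>I\<in>E. \<forall>J\<in>E. I \<noteq> J \<longrightarrow> I \<inter> J = {}"
    using assms(2) unfolding decomposable_def by blast
  have cross: "I \<inter> J = {}" if "I \<in> D" "J \<in> E" for I J
    using that D(2) E(2) assms(3) by blast
  have "\<forall>I\<in>D \<union> E. \<forall>J\<in>D \<union> E. I \<noteq> J \<longrightarrow> I \<inter> J = {}"
    using D(4) E(4) cross by (metis Un_iff inf_commute)
  then show ?thesis unfolding decomposable_def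
    by (intro exI[of _ "D \<union> E"]) (use D E in auto)
qed

lemma convex_singleton: "x \<in> L \<Longrightarrow> convex_in L lt {x}"
  unfolding convex_in_def using asym by blast

lemma decomposable_singleton:
  assumes "x \<in> L"
  shows "decomposable k {x}"
  by (rule decomposable_typed[where t = "S (k x)"])
     (use assms convex_singleton in \<open>auto simp: has_chi_type_def\<close>)

lemma decomposable_finite:
  assumes "finite X" "X \<subseteq> L"
  shows "decomposable k X"
  using assms
proof (induction X)
  case empty show ?case by (rule decomposable_empty)
next
  case (insert x X)
  then show ?case using decomposable_Un[OF decomposable_singleton[of x k], of X] by auto
qed

lemma decomposable_one_color:
  assumes "convex_in L lt X" "k ` X \<subseteq> {e}"
  shows "decomposable k X"
proof (cases "finite X")
  case True
  then show ?thesis using assms decomposable_finite by (simp add: convex_in_def)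
next
  case False
  then have ne: "X \<noteq> {}" by auto
  then have "k ` X = {e}" using assms by auto
  then have "has_chi_type lt k X (if e = Zero then I0 else S e)"
    using False by (auto simp: has_chi_type_def)
  then show ?thesis using decomposable_typed assms ne by blast
qed

text \<open>Cut off the longest initial segment avoiding the word without its last letter: what
  remains avoids the last letter, except possibly at its first point.\<close>
lemma decomposable_avoiding:
  assumes "convex_in L lt X" "\<not> color_chain lt k X c n"
    and "\<And>Y i. Y \<subseteq> X \<Longrightarrow> convex_in L lt Y \<Longrightarrow> c i \<notin> k ` Y \<Longrightarrow> decomposable k Y"
  shows "decomposable k X"
  using assms
proof (induction n arbitrary: X)
  case 0
  then show ?case by simp
next
  case (Suc n)
  show ?case
  proof (cases "n = 0")
    case True
    have "c 0 \<notin> k ` X"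
    proof
      assume "c 0 \<in> k ` X"
      then obtain x where "x \<in> X" "k x = c 0" by auto
      then have "color_chain lt k X c (Suc 0)"
        using color_chain_Suc[of lt k "{}" c 0 x X] by auto
      then show False using Suc.prems True by simp
    qed
    then show ?thesis using Suc.prems by blast
  next
    case False
    have XL: "X \<subseteq> L" using Suc.prems by (auto simp: convex_in_def)
    define down where "down x = {y \<in> X. y = x \<or> lt y x}" for x
    define X1 where "X1 = {x \<in> X. \<not> color_chain lt k (down x) c n}"
    have down_mono: "down y \<subseteq> down x" if "lt y x" "x \<in> X" "y \<in> X" for x y
      using that XL trans unfolding down_def by blast
    have X1_down: "y \<in> X1" if "x \<in> X1" "y \<in> X" "lt y x" for x y
      using that down_mono color_chain_mono unfolding X1_def by fastforce
    have conv: "z \<in> X" if "x \<in> X" "y \<in> X" "z \<in> L" "lt x z" "lt z y" for x y z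
      using that Suc.prems(1) unfolding convex_in_def by blast
    have c1: "convex_in L lt X1"
      unfolding convex_in_def using X1_down conv XL unfolding X1_def by blast
    have up: "y \<in> X - X1" if "x \<in> X - X1" "y \<in> X" "lt x y" for x y
      using that X1_down by blast
    have c2: "convex_in L lt (X - X1)"
      unfolding convex_in_def using up conv XL by blast
    \<comment> \<open>A chain inside the initial segment lies below its own last element, which
      itself belongs to \<open>X1\<close>.\<close>
    have nc1: "\<not> color_chain lt k X1 c n"
    proof
      assume "color_chain lt k X1 c n"
      then obtain a where a: "\<forall>i < n. a i \<in> X1 \<and> k (a i) = c i"
          "\<forall>i j. i < j \<and> j < n \<longrightarrow> lt (a i) (a j)"
        unfolding color_chain_def by blast
      have "a i \<in> down (a (n - 1))" if "i < n" for i
      proof (cases "i = n - 1")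
        case False
        then have "i < n - 1" using that by simp
        then show ?thesis using a that \<open>n \<noteq> 0\<close> unfolding down_def X1_def by auto
      qed (use a that in \<open>auto simp: down_def X1_def\<close>)
      then have "color_chain lt k (down (a (n - 1))) c n"
        unfolding color_chain_def using a by blast
      moreover have "a (n - 1) \<in> X1" using a(1) False by simp
      ultimately show False unfolding X1_def by blast
    qed
    have d1: "decomposable k X1"
      by (rule Suc.IH[OF c1 nc1]) (rule Suc.prems(3), auto simp: X1_def)
    \<comment> \<open>Outside \<open>X1\<close> the first \<open>n\<close> letters already occur up
      to \<open>x\<close>, so a later point of color \<open>c n\<close> would complete the
      word.\<close>
    have above: "k y \<noteq> c n" if "x \<in> X - X1" "y \<in> X" "lt x y" for x y
    proof
      assume "k y = c n"
      moreover have "color_chain lt k (down x) c n" using that X1_def by blast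
      moreover have "lt z y" if "z \<in> down x" for z
        using that \<open>x \<in> X - X1\<close> \<open>y \<in> X\<close> \<open>lt x y\<close> XL trans unfolding down_def by blast
      ultimately have "color_chain lt k X c (Suc n)"
        using color_chain_Suc[of lt k "down x" c n y X] that by (auto simp: down_def)
      then show False using Suc.prems by blast
    qed
    have d2: "decomposable k (X - X1)"
    proof (cases "c n \<in> k ` (X - X1)")
      case False
      then show ?thesis using Suc.prems(3)[of "X - X1"] c2 by blast
    next
      case True
      then obtain m where m: "m \<in> X - X1" "k m = c n" by auto
      define X3 where "X3 = {y \<in> X. lt m y}"
      have "lt m z" if "x \<in> X3" "z \<in> L" "lt x z" for x z
        using that m XL trans[of m x z] unfolding X3_def by blast
      then have "z \<in> X3" if "x \<in> X3" "y \<in> X3" "z \<in> L" "lt x z" "lt z y" for x y z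
        using that conv[of x y z] unfolding X3_def by simp
      moreover have "X3 \<subseteq> L" using XL unfolding X3_def by blast
      ultimately have c3: "convex_in L lt X3" unfolding convex_in_def by blast
      have "decomposable k X3"
        using Suc.prems(3)[of X3 n] c3 above[OF m(1)] by (force simp: X3_def)
      \<comment> \<open>A point of \<open>X - X1\<close> below \<open>m\<close> would forbid the
        color of \<open>m\<close> by \<open>above\<close>, so \<open>m\<close> comes first.\<close>
      moreover have "X - X1 = {m} \<union> X3"
      proof
        show "X - X1 \<subseteq> {m} \<union> X3"
          using m above total XL unfolding X3_def by blast
        show "{m} \<union> X3 \<subseteq> X - X1" using m up unfolding X3_def by blast
      qed
      moreover have "m \<notin> X3" using m XL irrefl unfolding X3_def by blast
      moreover have "m \<in> L" using m XL by blast
      ultimately show ?thesis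
        using decomposable_Un[OF decomposable_singleton[of m k], of X3] by auto
    qed
    have "X = X1 \<union> (X - X1)" unfolding X1_def by blast
    then show ?thesis using decomposable_Un[OF d1 d2] by auto
  qed
qed

lemma decomposable_two_color:
  assumes "convex_in L lt X" "k ` X \<subseteq> {e1, e2}"
    and "(e1, e2, t) \<in> {(Pos, Neg, IPM), (Pos, Zero, IPZ), (Neg, Zero, IMZ)}"
  shows "decomposable k X"
proof (cases "\<forall>n. color_chain lt k X (alt2 e1 e2) (2 * (n + 1))")
  case True
  then have "color_chain lt k X (alt2 e1 e2) 2" by (metis add_0 mult.right_neutral)
  then obtain a where a: "\<forall>i < 2. a i \<in> X \<and> k (a i) = alt2 e1 e2 i"
    unfolding color_chain_def by blast
  have "a 0 \<in> X \<and> k (a 0) = e1" "a 1 \<in> X \<and> k (a 1) = e2"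
    using a by (auto simp: alt2_def)
  then have "e1 \<in> k ` X" "e2 \<in> k ` X" by blast+
  with assms(2) have "k ` X = {e1, e2}" by blast
  with True have "type_alt lt k X e1 e2" unfolding type_alt_iff_chain by blast
  then have "has_chi_type lt k X t" using assms(3) by (auto simp: has_chi_type_def)
  then show ?thesis using decomposable_typed assms(1) \<open>e1 \<in> k ` X\<close> by blast
next
  case False
  then obtain n where n: "\<not> color_chain lt k X (alt2 e1 e2) (2 * (n + 1))" by blast
  show ?thesis
  proof (rule decomposable_avoiding[OF assms(1) n])
    fix Y i assume Y: "Y \<subseteq> X" "convex_in L lt Y" "alt2 e1 e2 i \<notin> k ` Y"
    then have "k ` Y \<subseteq> {e1} \<or> k ` Y \<subseteq> {e2}"
      using assms(2) by (auto simp: alt2_def split: if_splits)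
    then show "decomposable k Y" using decomposable_one_color Y(2) by blast
  qed
qed

text \<open>Two rounds of cutting: avoiding a cyclic word leaves pieces with at most two colors.
  Such a piece either alternates without bound, and then has an infinite type itself, or it avoids
  an alternating word and is cut into pieces of one color.\<close>

lemma decomposable_not_inf3:
  assumes "\<not> type_inf3 lt k L"
  shows "decomposable k L"
proof -
  obtain n where n: "\<not> color_chain lt k L cyc3 (3 * (n + 1))"
    using assms unfolding type_inf3_iff_chain by blast
  have "convex_in L lt L" by (simp add: convex_in_def)
  then show ?thesis
  proof (rule decomposable_avoiding[OF _ n])
    fix Y i assume Y: "convex_in L lt Y" "cyc3 i \<notin> k ` Y"
    have "k ` Y \<subseteq> {Pos, Neg} \<or> k ` Y \<subseteq> {Pos, Zero} \<or> k ` Y \<subseteq> {Neg, Zero}"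
      by (rule image_two_colors[OF Y(2)])
    then show "decomposable k Y" using decomposable_two_color[OF Y(1)] by blast
  qed
qed

lemma ex_decomp:
  assumes "\<not> type_inf3 lt k L"
  shows "\<exists>D c. is_decomp L lt k D c"
proof -
  obtain D where D: "finite D" "\<Union>D = L"
     "\<forall>I\<in>D. I \<noteq> {} \<and> convex_in L lt I \<and> (\<exists>t. has_chi_type lt k I t)"
     "\<forall>I\<in>D. \<forall>J\<in>D. I \<noteq> J \<longrightarrow> I \<inter> J = {}"
    using decomposable_not_inf3[OF assms] unfolding decomposable_def by blast
  obtain c where "\<forall>I\<in>D. has_chi_type lt k I (c I)" using D(3) by metis
  then show ?thesis using D unfolding is_decomp_def by blast
qed

end

section \<open>Canonical decompositions\<close>

lemma betw_commute: "betw lt x y z \<longleftrightarrow> betw lt y x z"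
  unfolding betw_def by auto

lemma chi_le_refl [simp]: "chi_le x x"
  by (simp add: chi_le_def)

lemma inf2_commute: "inf2 e e' = inf2 e' e"
  unfolding inf2_def by (simp add: insert_commute)

text \<open>Only three types have two colors, so \<open>u\<close> is the third one beside
  \<open>s\<close> and \<open>t\<close>. Its two colors are the color missing from \<open>s\<close>
  and the color missing from \<open>t\<close>.\<close>

lemma canonical_gap_types:
  assumes "s \<in> {IPM, IPZ, IMZ}" "t \<in> {IPM, IPZ, IMZ}" "s \<noteq> t" "u \<notin> {S Pos, S Neg, S Zero, I0, s, t}"
  shows "\<exists>e e'. e \<noteq> e' \<and> u = inf2 e e' \<and> \<not> chi_le (S e) s \<and> \<not> chi_le (S e') t"
proof -
  have u: "u = inf2 Zero Neg \<or> u = inf2 Zero Pos \<or> u = inf2 Neg Pos"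
    using assms(4) by (cases u rule: chi.exhaust; simp add: inf2_def insert_commute doubleton_eq_iff; use color.exhaust in blast)
  show ?thesis
    using assms u by (elim insertE; simp add: chi_le_def inf2_def insert_commute doubleton_eq_iff; blast)
qed

context strict_lin
begin

text \<open>Iterating condition (1) of canonicity would produce infinitely many points between \<open>u\<close> and \<open>v\<close>.\<close>
lemma no_constant_interval:
  assumes "finite L" and sep: "\<And>x y. x \<in> L \<Longrightarrow> y \<in> L \<Longrightarrow> x \<noteq> y \<Longrightarrow> chi_le (c x) (c y) \<Longrightarrow> \<exists>z\<in>L. betw lt x y z"
    and "u \<in> L" "v \<in> L" "lt u v" "c v = c u" "\<And>w. w \<in> L \<Longrightarrow> betw lt u v w \<Longrightarrow> c w = c u"
  shows False
  using assms(4-)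
proof (induction "card {w \<in> L. betw lt u v w}" arbitrary: v rule: less_induct)
  case less
  obtain z where z: "z \<in> L" "betw lt u v z"
    using sep[of u v] less.prems assms(3) irrefl by auto
  have uz: "lt u z" "lt z v"
    using z less.prems asym[of u v] trans[of v z u] assms(3) unfolding betw_def by blast+
  have sub: "betw lt u v w" if "w \<in> L" "betw lt u z w" for w
  proof -
    have "lt u w \<and> lt w z"
      using that uz z(1) assms(3) asym[of u z] trans[of z w u] unfolding betw_def by blast
    then show ?thesis using that(1) uz z(1) less.prems(1) trans[of w z v] unfolding betw_def by blast
  qed
  have "\<not> betw lt u z z" using irrefl z(1) unfolding betw_def by blast
  then have "{w \<in> L. betw lt u z w} \<subset> {w \<in> L. betw lt u v w}" using sub z by blast
  then have "card {w \<in> L. betw lt u z w} < card {w \<in> L. betw lt u v w}"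
    using assms(1) by (intro psubset_card_mono) auto
  then show False
    using less.hyps[of z] z uz less.prems sub by auto
qed

text \<open>Condition (2) of canonicity follows from condition (1): if there is no interval of the third
  infinite type in the gap, then two adjacent points of the gap have different types, and a
  single point in the gap would have a type comparable to that of one of its neighbours.\<close>
lemma canonicalI:
  assumes fin: "finite L"
    and sep: "\<And>x y. x \<in> L \<Longrightarrow> y \<in> L \<Longrightarrow> x \<noteq> y \<Longrightarrow> chi_le (c x) (c y) \<Longrightarrow> \<exists>z\<in>L. betw lt x y z"
  shows "canonical L lt c"
proof -
  have gap: "(\<exists>z1\<in>L. \<exists>z2\<in>L. (lt x z1 \<and> lt z1 z2 \<and> lt z2 y)
          \<and> c z1 \<noteq> c z2
          \<and> c z1 \<in> {S Pos, S Neg, S Zero, I0, c x, c y}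
          \<and> c z2 \<in> {S Pos, S Neg, S Zero, I0, c x, c y}) \<or>
      (\<exists>z\<in>L. betw lt x y z \<and> (\<exists>e e'. e \<noteq> e' \<and> c z = inf2 e e'
          \<and> \<not> chi_le (S e) (c x) \<and> \<not> chi_le (S e') (c y)))" (is "?A \<or> ?B")
    if xy: "x \<in> L" "y \<in> L" "lt x y" and ne: "\<exists>z\<in>L. betw lt x y z"
      and inf: "c x \<in> {IPM, IPZ, IMZ}" "c y \<in> {IPM, IPZ, IMZ}" "c x \<noteq> c y" for x y
  proof (rule ccontr)
    assume contr: "\<not> (?A \<or> ?B)"
    have bt: "betw lt x y z \<longleftrightarrow> lt x z \<and> lt z y" if "z \<in> L" for z
      using that xy asym[of x y] trans[of y z x] unfolding betw_def by blast
    have types: "c z \<in> {S Pos, S Neg, S Zero, I0, c x, c y}" if "z \<in> L" "betw lt x y z" for z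
      using contr canonical_gap_types[OF inf, of "c z"] that by blast
    have const: "c z = c z'" if "z \<in> L" "betw lt x y z" "z' \<in> L" "betw lt x y z'" for z z'
      using contr types[of z] types[of z'] that total[of z z'] by (metis bt)
    obtain z where z: "z \<in> L" "betw lt x y z" using ne by blast
    \<comment> \<open>All points of the gap now have the same type, and
      \<open>no_constant_interval\<close> leaves room for one such point only.\<close>
    have uniq: "z' = z" if z': "z' \<in> L" "betw lt x y z'" for z'
    proof (rule ccontr)
      assume "z' \<noteq> z"
      have *: False if "u \<in> L" "betw lt x y u" "v \<in> L" "betw lt x y v" "lt u v" for u v
      proof (rule no_constant_interval[OF fin sep that(1,3,5), of c])
        show "c v = c u" using const that by blast
        fix w assume w: "w \<in> L" "betw lt u v w"
        then have "lt u w \<and> lt w v"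
          using that asym[of u v] trans[of v w u] unfolding betw_def by blast
        then have "lt x w \<and> lt w y"
          using that bt[of u] bt[of v] xy w trans[of x u w] trans[of w v y] by blast
        then show "c w = c u" using const[of w u] that bt w by blast
      qed auto
      then show False using z z' total[of z z'] \<open>z' \<noteq> z\<close> by blast
    qed
    have left: "\<not> betw lt x z w" if "w \<in> L" for w
    proof
      assume "betw lt x z w"
      then have "lt x w \<and> lt w z"
        using that z bt[of z] xy(1) asym[of x z] trans[of z w x] unfolding betw_def by blast
      moreover from this have "lt w y" using trans[of w z y] that z bt[of z] xy by blast
      ultimately show False using uniq[of w] bt[of w] that irrefl[of w] by blast
    qed
    have right: "\<not> betw lt z y w" if "w \<in> L" for w
    proof
      assume "betw lt z y w"
      then have "lt z w \<and> lt w y"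
        using that z bt[of z] xy(2) asym[of z y] trans[of y w z] unfolding betw_def by blast
      moreover from this have "lt x w" using trans[of x z w] that z bt[of z] xy by blast
      ultimately show False using uniq[of w] bt[of w] that irrefl[of w] by blast
    qed
    have nz: "x \<noteq> z" "z \<noteq> y" using bt[of z] z irrefl by blast+
    \<comment> \<open>\<open>z\<close> is adjacent to both \<open>x\<close> and \<open>y\<close>, so
      condition (1) puts its type below neither of theirs. But two distinct two-color types together
      involve all three colors, so every type still allowed for \<open>z\<close> lies below one of
      them.\<close>
    have "\<not> chi_le (c z) (c x)" "\<not> chi_le (c z) (c y)"
      using sep[of z x] sep[of z y] left right nz xy z betw_commute by metis+
    moreover have "c z \<in> {S Pos, S Neg, S Zero, I0, c x, c y}" using types z by blast
    ultimately show False
      using inf by (elim insertE; simp add: chi_le_def)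
  qed
  show ?thesis unfolding canonical_def
  proof (intro conjI ballI impI fin)
    fix x y assume "x \<in> L" "y \<in> L" "x \<noteq> y \<and> chi_le (c x) (c y)"
    then show "\<exists>z\<in>L. betw lt x y z" using sep by blast
  next
    fix x y
    assume xy: "x \<in> L" "y \<in> L"
      and H: "(\<exists>z\<in>L. betw lt x y z) \<and> c x \<in> {IPM, IPZ, IMZ} \<and> c y \<in> {IPM, IPZ, IMZ} \<and> c x \<noteq> c y"
    show "(\<exists>z1\<in>L. \<exists>z2\<in>L. ((lt x z1 \<and> lt z1 z2 \<and> lt z2 y) \<or> (lt y z1 \<and> lt z1 z2 \<and> lt z2 x))
          \<and> c z1 \<noteq> c z2
          \<and> c z1 \<in> {S Pos, S Neg, S Zero, I0, c x, c y}
          \<and> c z2 \<in> {S Pos, S Neg, S Zero, I0, c x, c y}) \<or>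
      (\<exists>z\<in>L. betw lt x y z \<and> (\<exists>e e'. e \<noteq> e' \<and> c z = inf2 e e'
          \<and> \<not> chi_le (S e) (c x) \<and> \<not> chi_le (S e') (c y)))" (is "?A \<or> ?B")
    proof -
      have "x \<noteq> y" using H by blast
      then consider "lt x y" | "lt y x" using total xy by blast
      then show ?thesis
      proof cases
        case 1
        from gap[OF xy 1] H show ?thesis by blast
      next
        case 2
        have yx: "\<exists>z\<in>L. betw lt y x z" using H betw_commute by metis
        have "c y \<in> {IPM, IPZ, IMZ}" "c x \<in> {IPM, IPZ, IMZ}" "c y \<noteq> c x" using H by auto
        from gap[OF xy(2,1) 2 yx this] show ?thesis
        proof
          assume "\<exists>z1\<in>L. \<exists>z2\<in>L. (lt y z1 \<and> lt z1 z2 \<and> lt z2 x) \<and> c z1 \<noteq> c z2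
            \<and> c z1 \<in> {S Pos, S Neg, S Zero, I0, c y, c x} \<and> c z2 \<in> {S Pos, S Neg, S Zero, I0, c y, c x}"
          then have ?A by (simp add: insert_commute[of "c y" "c x"]) blast
          then show ?thesis ..
        next
          assume "\<exists>z\<in>L. betw lt y x z \<and> (\<exists>e e'. e \<noteq> e' \<and> c z = inf2 e e'
            \<and> \<not> chi_le (S e) (c y) \<and> \<not> chi_le (S e') (c x))"
          then have ?B using betw_commute inf2_commute by metis
          then show ?thesis ..
        qed
      qed
    qed
  qed
qed

end

text \<open>Unbounded alternation and infinitude survive enlargement by points of admissible colors.
  The excluded case is genuine: two distinct points of color 0 form a set that has neither type
  \<open>S Zero\<close> nor \<open>I0\<close>.\<close>

lemma has_chi_type_Un:
  assumes "has_chi_type lt k X s" "has_chi_type lt k Y t" "chi_le s t" "\<not> (s = S Zero \<and> t = S Zero)"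
  shows "has_chi_type lt k (X \<union> Y) t"
proof -
  have alt: "type_alt lt k (X \<union> Y) e1 e2" if "type_alt lt k Y e1 e2" "k ` X \<subseteq> {e1, e2}" for e1 e2
  proof -
    have "color_chain lt k (X \<union> Y) (alt2 e1 e2) (2 * (n + 1))" for n
      using that(1) color_chain_mono[of lt k Y _ _ "X \<union> Y"] unfolding type_alt_iff_chain by simp
    moreover have "k ` (X \<union> Y) = {e1, e2}"
      using that unfolding type_alt_iff_chain image_Un by auto
    ultimately show ?thesis unfolding type_alt_iff_chain by simp
  qed
  have kX: "k ` X \<subseteq> (case s of S e \<Rightarrow> {e} | I0 \<Rightarrow> {Zero} | IPM \<Rightarrow> {Pos, Neg} | IPZ \<Rightarrow> {Pos, Zero} | IMZ \<Rightarrow> {Neg, Zero})"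
    using assms(1) by (auto simp: has_chi_type_def type_alt_def split: chi.splits)
  show ?thesis
  proof (cases t)
    case (S e)
    then have "s = S e" "e \<noteq> Zero" using assms(3,4) by (auto simp: chi_le_def)
    then show ?thesis using assms(1,2) S by (auto simp: has_chi_type_def image_Un)
  next
    case I0
    then have "s = I0 \<or> s = S Zero" using assms(3) by (auto simp: chi_le_def)
    then have "k ` X = {Zero}" using assms(1) by (elim disjE) (simp_all add: has_chi_type_def)
    then show ?thesis using assms(2) I0 by (auto simp: has_chi_type_def image_Un)
  next
    case IPM
    then have "k ` X \<subseteq> {Pos, Neg}" using assms(3) kX by (auto simp: chi_le_def)
    then show ?thesis using assms(2) IPM alt by (simp add: has_chi_type_def)
  next
    case IPZ
    then have "k ` X \<subseteq> {Pos, Zero}" using assms(3) kX by (auto simp: chi_le_def)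
    then show ?thesis using assms(2) IPZ alt by (simp add: has_chi_type_def)
  next
    case IMZ
    then have "k ` X \<subseteq> {Neg, Zero}" using assms(3) kX by (auto simp: chi_le_def)
    then show ?thesis using assms(2) IMZ alt by (simp add: has_chi_type_def)
  qed
qed

lemma has_chi_type_color:
  assumes "has_chi_type lt k X t" "x \<in> X"
  shows "chi_le (S (k x)) t"
proof -
  have "k x \<in> k ` X" using assms(2) by blast
  then show ?thesis
    using assms(1) by (cases t) (auto simp: has_chi_type_def type_alt_def chi_le_def)
qed

section \<open>The cells of a decomposition and their merging\<close>

context strict_lin
begin

lemma decomp_cell:
  assumes "is_decomp L lt k D c" "I \<in> D"
  shows "I \<noteq> {}" "I \<subseteq> L" "convex_in L lt I" "has_chi_type lt k I (c I)"
proof -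
  have *: "I \<noteq> {} \<and> convex_in L lt I \<and> has_chi_type lt k I (c I)"
    using assms unfolding is_decomp_def by simp
  then show "I \<noteq> {}" "convex_in L lt I" "has_chi_type lt k I (c I)" by simp_all
  from * show "I \<subseteq> L" unfolding convex_in_def by simp
qed

lemma decomp_basic:
  assumes "is_decomp L lt k D c"
  shows "finite D" "\<Union>D = L" "\<And>I J. I \<in> D \<Longrightarrow> J \<in> D \<Longrightarrow> I \<noteq> J \<Longrightarrow> I \<inter> J = {}"
  using assms unfolding is_decomp_def by simp_all

text \<open>If \<open>y\<close> preceded \<open>x\<close>, convexity of \<open>I\<close> would force
  \<open>x\<close> before \<open>b\<close>, and then convexity of \<open>J\<close> would put
  \<open>x\<close> into \<open>J\<close>.\<close>

lemma decomp_cells_setlt: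
  assumes D: "is_decomp L lt k D c" and IJ: "I \<in> D" "J \<in> D" "I \<noteq> J" and ab: "a \<in> I" "b \<in> J" "lt a b"
  shows "setlt lt I J"
  unfolding setlt_def
proof (intro ballI)
  fix x y assume x: "x \<in> I" and y: "y \<in> J"
  have disj: "I \<inter> J = {}" using decomp_basic(3)[OF D] IJ by simp
  have L: "x \<in> L" "y \<in> L" "a \<in> L" "b \<in> L"
    using decomp_cell(2)[OF D IJ(1)] decomp_cell(2)[OF D IJ(2)] x y ab by blast+
  have cI: "\<And>u v z. u \<in> I \<Longrightarrow> v \<in> I \<Longrightarrow> z \<in> L \<Longrightarrow> lt u z \<Longrightarrow> lt z v \<Longrightarrow> z \<in> I"
    using decomp_cell(3)[OF D IJ(1)] unfolding convex_in_def by blast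
  have cJ: "\<And>u v z. u \<in> J \<Longrightarrow> v \<in> J \<Longrightarrow> z \<in> L \<Longrightarrow> lt u z \<Longrightarrow> lt z v \<Longrightarrow> z \<in> J"
    using decomp_cell(3)[OF D IJ(2)] unfolding convex_in_def by blast
  show "lt x y"
  proof (rule ccontr)
    assume "\<not> lt x y"
    then have yx: "lt y x" using total[of x y] L x y disj by blast
    have "\<not> lt b x" using cI[of a x b] ab x L disj by blast
    then have "lt x b" using total[of x b] L x ab disj by blast
    then have "x \<in> J" using cJ[of y b x] y ab yx L by blast
    then show False using x disj by blast
  qed
qed

text \<open>\<open>setlt\<close> relates the empty set to every set in both directions, so
  irreflexivity and transitivity rest on the cells being nonempty. The facts about finite canonical
  orders then apply to the family of cells.\<close>

lemma decomp_strict_lin: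
  assumes D: "is_decomp L lt k D c"
  shows "strict_lin D (setlt lt)"
proof
  fix I assume "I \<in> D"
  then obtain i where "i \<in> I" "i \<in> L" using decomp_cell(1,2)[OF D, of I] by blast
  then show "\<not> setlt lt I I" using irrefl unfolding setlt_def by blast
next
  fix I J K assume IJK: "I \<in> D" "J \<in> D" "K \<in> D" "setlt lt I J" "setlt lt J K"
  obtain j where "j \<in> J" using decomp_cell(1)[OF D IJK(2)] by blast
  moreover have "I \<subseteq> L" "J \<subseteq> L" "K \<subseteq> L" using decomp_cell(2)[OF D] IJK by auto
  ultimately have "lt x z" if "x \<in> I" "z \<in> K" for x z
    using trans[of x j z] that IJK(4,5) unfolding setlt_def by blast
  then show "setlt lt I K" unfolding setlt_def by blast
next
  fix I J assume IJ: "I \<in> D" "J \<in> D" "I \<noteq> J"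
  obtain i j where "i \<in> I" "j \<in> J" using decomp_cell(1)[OF D IJ(1)] decomp_cell(1)[OF D IJ(2)] by blast
  moreover from this have "i \<in> L" "j \<in> L" using decomp_cell(2)[OF D] IJ by auto
  moreover have "I \<inter> J = {}" using decomp_basic(3)[OF D] IJ by simp
  ultimately show "setlt lt I J \<or> setlt lt J I"
    using decomp_cells_setlt[OF D] IJ total[of i j] by blast
qed

text \<open>Minimality of a decomposition acts through this merge: neighbors that violate condition
  (1) of canonicity collapse into one interval of the larger type.\<close>

lemma decomp_merge:
  assumes D: "is_decomp L lt k D c" and IJ: "I \<in> D" "J \<in> D" "I \<noteq> J"
    and adj: "\<And>K. K \<in> D \<Longrightarrow> \<not> betw (setlt lt) I J K" and le: "chi_le (c I) (c J)"
    and nz: "\<not> (c I = S Zero \<and> c J = S Zero)"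
  shows "is_decomp L lt k (insert (I \<union> J) (D - {I, J})) (c(I \<union> J := c J))"
proof -
  note U = decomp_basic(2)[OF D]
  have conv: "z \<in> I \<union> J" if asm: "x \<in> I \<union> J" "y \<in> I \<union> J" "z \<in> L" "lt x z" "lt z y" for x y z
  proof (rule ccontr)
    assume z: "z \<notin> I \<union> J"
    obtain K where K: "K \<in> D" "z \<in> K" using U asm by blast
    then have KI: "K \<noteq> I" "K \<noteq> J" using z by blast+
    have cI: "\<not> (x \<in> I \<and> y \<in> I)" "\<not> (x \<in> J \<and> y \<in> J)"
      using decomp_cell(3)[OF D IJ(1)] decomp_cell(3)[OF D IJ(2)] asm(3-) z unfolding convex_in_def by blast+
    have "betw (setlt lt) I J K"
      using asm(1,2) cI KI K IJ asm(4,5) decomp_cells_setlt[OF D] unfolding betw_def by (metis UnE)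
    then show False using adj K by blast
  qed
  have "I \<union> J \<subseteq> L" using decomp_cell(2)[OF D] IJ by simp
  then have "convex_in L lt (I \<union> J)" unfolding convex_in_def using conv by (metis (no_types))
  moreover have "has_chi_type lt k (I \<union> J) (c J)"
    using has_chi_type_Un[OF decomp_cell(4)[OF D IJ(1)] decomp_cell(4)[OF D IJ(2)] le nz] .
  moreover have "I \<union> J \<noteq> {}" using decomp_cell(1)[OF D] IJ by simp
  moreover note disj = decomp_basic(3)[OF D]
  have ne: "K \<noteq> I \<union> J" "(I \<union> J) \<inter> K = {}" if "K \<in> D - {I, J}" for K
  proof -
    show "(I \<union> J) \<inter> K = {}" using that disj[of I K] disj[of J K] IJ by blast
    then show "K \<noteq> I \<union> J" using decomp_cell(1)[OF D, of K] that by blast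
  qed
  moreover have "\<Union>(insert (I \<union> J) (D - {I, J})) = L" using U IJ by blast
  moreover have "finite (insert (I \<union> J) (D - {I, J}))" using decomp_basic(1)[OF D] by simp
  moreover have "K \<inter> K' = {}" if "K \<in> insert (I \<union> J) (D - {I, J})" "K' \<in> insert (I \<union> J) (D - {I, J})" "K \<noteq> K'" for K K'
    using that ne(2)[of K] ne(2)[of K'] disj[of K K'] by blast
  ultimately show ?thesis
    unfolding is_decomp_def using decomp_cell[OF D] by simp
qed

text \<open>\<open>dense\<close> excludes the one pair of comparable neighbors that cannot be
  merged, two single points of color 0.\<close>

lemma ex_canonical_decomp:
  assumes ninf: "\<not> type_inf3 lt k L"
    and dense: "\<And>u v. u \<in> L \<Longrightarrow> v \<in> L \<Longrightarrow> k u = Zero \<Longrightarrow> k v = Zero \<Longrightarrow> lt u v \<Longrightarrow> \<exists>w\<in>L. lt u w \<and> lt w v"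
  shows "\<exists>D c. canonical_decomp L lt k D c"
proof -
  obtain D where D: "\<exists>c. is_decomp L lt k D c"
    and least: "\<And>D'. (\<exists>c. is_decomp L lt k D' c) \<Longrightarrow> card D \<le> card D'"
    using ex_decomp[OF ninf] ex_has_least_nat[of "\<lambda>D. \<exists>c. is_decomp L lt k D c" _ card] by blast
  then obtain c where c: "is_decomp L lt k D c" by blast
  note fin = decomp_basic(1)[OF c] and U = decomp_basic(2)[OF c]
  interpret D: strict_lin D "setlt lt" by (rule decomp_strict_lin[OF c])
  have "canonical D (setlt lt) c"
  proof (rule D.canonicalI[OF fin], rule ccontr)
    fix I J assume IJ: "I \<in> D" "J \<in> D" "I \<noteq> J" "chi_le (c I) (c J)"
      and "\<not> (\<exists>K\<in>D. betw (setlt lt) I J K)"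
    then have adj: "\<not> betw (setlt lt) I J K" if "K \<in> D" for K using that by blast
    have nz: "\<not> (c I = S Zero \<and> c J = S Zero)"
    proof
      assume "c I = S Zero \<and> c J = S Zero"
      then have cd: "card I = 1" "card J = 1" "k ` I = {Zero}" "k ` J = {Zero}"
        using decomp_cell(4)[OF c IJ(1)] decomp_cell(4)[OF c IJ(2)] by (simp_all add: has_chi_type_def)
      have *: False if IJ: "I \<in> D" "J \<in> D" "I \<noteq> J" and adj: "\<And>K. K \<in> D \<Longrightarrow> \<not> betw (setlt lt) I J K"
        and lt: "setlt lt I J" and cd: "card I = 1" "card J = 1" "k ` I = {Zero}" "k ` J = {Zero}" for I J
      proof -
        obtain u v where uv: "I = {u}" "J = {v}" using cd by (meson card_1_singletonE)
        have uvL: "u \<in> L" "v \<in> L" "lt u v" "k u = Zero" "k v = Zero"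
          using uv cd lt IJ U unfolding setlt_def by auto
        obtain w where w: "w \<in> L" "lt u w" "lt w v" using dense uvL by blast
        obtain K where K: "K \<in> D" "w \<in> K" using w U by blast
        have "K \<noteq> I" "K \<noteq> J" using uv w K irrefl uvL by auto
        then have "betw (setlt lt) I J K"
          unfolding betw_def using decomp_cells_setlt[OF c] IJ K uv w by blast
        then show False using adj K by blast
      qed
      from IJ(1,2,3) D.total consider "setlt lt I J" | "setlt lt J I" by blast
      then show False
      proof cases
        case 1 then show False using *[OF IJ(1,2,3) adj _ cd] by blast
      next
        case 2 then show False
          using *[OF IJ(2,1) IJ(3)[symmetric] _ _ cd(2,1,4,3)] adj betw_commute by metis
      qed
    qed
    have "card D \<le> card (insert (I \<union> J) (D - {I, J}))"
      using least decomp_merge[OF c IJ(1,2,3) adj IJ(4) nz] by blast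
    also have "\<dots> \<le> Suc (card (D - {I, J}))" by (simp add: card_insert_if fin)
    also have "card (D - {I, J}) = card D - 2" using IJ fin by (simp add: card_Diff_subset)
    finally have "card D \<le> Suc (card D - 2)" .
    \<comment> \<open>Guards against truncation in \<open>card D - 2\<close>: for
      \<open>card D = 1\<close> the inequality just obtained would be no contradiction.\<close>
    moreover have "card {I, J} \<le> card D" using IJ fin by (intro card_mono) auto
    ultimately show False using IJ(3) by simp
  qed
  then show ?thesis using c unfolding canonical_decomp_def by blast
qed

end

section \<open>Homomorphisms of finite suborders\<close>

text \<open>The map may change with \<open>F\<close>, and this is weaker than one homomorphism on
  \<open>L\<close>: an infinite descending sequence of alternating colors has such maps into an
  ascending one, but no single homomorphism.\<close>

definition fin_hom :: "'a set \<Rightarrow> ('a \<Rightarrow> 'a \<Rightarrow> bool) \<Rightarrow> ('a \<Rightarrow> color)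
    \<Rightarrow> 'b set \<Rightarrow> ('b \<Rightarrow> 'b \<Rightarrow> bool) \<Rightarrow> ('b \<Rightarrow> color) \<Rightarrow> bool" where
  "fin_hom L lt k L' lt' k' \<longleftrightarrow> (\<forall>F. finite F \<and> F \<subseteq> L \<longrightarrow> (\<exists>phi. wp_hom F lt k L' lt' k' phi))"

lemma fin_homD:
  assumes "fin_hom L lt k L' lt' k'" "finite F" "F \<subseteq> L"
  obtains phi where "\<forall>x\<in>F. phi x \<in> L' \<and> k' (phi x) = k x"
    "\<forall>x\<in>F. \<forall>y\<in>F. lew lt x y \<longrightarrow> lew lt' (phi x) (phi y)"
    "\<forall>x\<in>F. \<forall>y\<in>F. k x = Zero \<longrightarrow> phi x = phi y \<longrightarrow> x = y"
proof -
  obtain phi where phi: "wp_hom F lt k L' lt' k' phi" using assms unfolding fin_hom_def by blast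
  have "x = y" if xy: "x \<in> F" "y \<in> F" "k x = Zero" "phi x = phi y" for x y
  proof -
    have "k y = Zero" using phi xy unfolding wp_hom_def by metis
    then show ?thesis using phi xy unfolding wp_hom_def inj_on_def by simp
  qed
  then have inj: "\<forall>x\<in>F. \<forall>y\<in>F. k x = Zero \<longrightarrow> phi x = phi y \<longrightarrow> x = y" by blast
  show thesis by (rule that[OF _ _ inj]) (use phi in \<open>simp_all add: wp_hom_def\<close>)
qed

context strict_lin
begin

lemma rank_less:
  assumes "finite F" "F \<subseteq> L" "x \<in> F" "y \<in> F" "lt x y"
  shows "card {z \<in> F. lt z x} < card {z \<in> F. lt z y}"
proof (rule psubset_card_mono)
  have "lt z y" if "z \<in> F" "lt z x" for z
    using trans[of z x y] that assms by blast
  moreover have "\<not> lt x x" using irrefl assms by blast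
  ultimately show "{z \<in> F. lt z x} \<subset> {z \<in> F. lt z y}" using assms by blast
qed (use assms in simp)

lemma rank_bound:
  assumes "finite F" "F \<subseteq> L" "x \<in> F"
  shows "card {z \<in> F. lt z x} < card F"
proof (rule psubset_card_mono)
  have "\<not> lt x x" using irrefl assms by blast
  then show "{z \<in> F. lt z x} \<subset> F" using assms by blast
qed (use assms in simp)

text \<open>Ranking the points of an \<open>n\<close>-element subset by their number of predecessors
  enumerates it increasingly.\<close>

lemma infinite_color_chain:
  assumes "infinite J" "J \<subseteq> L" "\<And>x. x \<in> J \<Longrightarrow> k x = e"
  shows "color_chain lt k J (\<lambda>_. e) n"
proof -
  obtain F where F: "F \<subseteq> J" "finite F" "card F = n"
    using infinite_arbitrarily_large[OF assms(1)] by blast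
  define r where "r x = card {z \<in> F. lt z x}" for x
  have FL: "F \<subseteq> L" using F assms by blast
  have less: "r x < r y" if "x \<in> F" "y \<in> F" "lt x y" for x y
    using rank_less[OF F(2) FL that] unfolding r_def .
  have inj: "inj_on r F"
  proof (rule inj_onI, rule ccontr)
    fix x y assume "x \<in> F" "y \<in> F" "r x = r y" "x \<noteq> y"
    then show False using less[of x y] less[of y x] total[of x y] FL by auto
  qed
  have "r ` F \<subseteq> {..<n}" using rank_bound[OF F(2) FL] F(3) unfolding r_def by blast
  then have im: "r ` F = {..<n}"
    using card_image[OF inj] F(3) by (simp add: card_subset_eq)
  define a where "a = inv_into F r"
  have a: "a i \<in> F" "r (a i) = i" if "i < n" for i
    using that im unfolding a_def by (simp_all add: inv_into_into f_inv_into_f)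
  have "lt (a i) (a j)" if "i < j" "j < n" for i j
  proof -
    have "a i \<noteq> a j" using a[of i] a[of j] that by auto
    moreover have "\<not> lt (a j) (a i)" using less[of "a j" "a i"] a[of i] a[of j] that by auto
    ultimately show ?thesis using total[of "a i" "a j"] a(1)[of i] a(1)[of j] that FL by (metis order.strict_trans subsetD)
  qed
  then show ?thesis unfolding color_chain_def using a(1) F(1) assms(3) by (intro exI[of _ a]) blast
qed

text \<open>The chain is read in blocks of \<open>p\<close> letters. A point goes to the block
  numbered by its rank in \<open>F\<close>, at the position \<open>off (k x)\<close> where its color
  occurs; distinct ranks use distinct blocks, so the map is strictly increasing. The spare last
  block matches the factor \<open>n + 1\<close> in the definitions of the types.\<close>

lemma color_chain_wp_hom:
  assumes F: "finite F" "F \<subseteq> L"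
    and off: "\<And>x. x \<in> F \<Longrightarrow> off (k x) < p" "\<And>x i. x \<in> F \<Longrightarrow> c (p * i + off (k x)) = k x"
    and chain: "color_chain lt' k' J c (p * (card F + 1))"
    and irr: "\<And>y. y \<in> J \<Longrightarrow> \<not> lt' y y"
  shows "\<exists>phi. wp_hom F lt k J lt' k' phi"
proof -
  obtain a where a: "\<forall>i < p * (card F + 1). a i \<in> J \<and> k' (a i) = c i"
    "\<forall>i j. i < j \<and> j < p * (card F + 1) \<longrightarrow> lt' (a i) (a j)"
    using chain unfolding color_chain_def by blast
  define r where "r x = card {z \<in> F. lt z x}" for x
  define g where "g x = p * r x + off (k x)" for x
  define phi where "phi x = a (g x)" for x
  have Suc_bound: "p * i + u < p * j" if "i < j" "u < p" for i j u
  proof -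
    have "p * i + u < p * Suc i" using that by simp
    also have "\<dots> \<le> p * j" using that by (intro mult_le_mono2) simp
    finally show ?thesis .
  qed
  have g_bound: "g x < p * (card F + 1)" if "x \<in> F" for x
    unfolding g_def by (rule Suc_bound) (use rank_bound[OF F that] off(1)[OF that] in \<open>simp_all add: r_def\<close>)
  have g_less: "g x < g y" if "x \<in> F" "y \<in> F" "lt x y" for x y
    using Suc_bound[OF rank_less[OF F that] off(1)[OF that(1)]] unfolding g_def r_def by linarith
  have lt: "lt' (phi x) (phi y)" if "x \<in> F" "y \<in> F" "lt x y" for x y
    using a(2) g_less[OF that] g_bound[OF that(2)] unfolding phi_def by blast
  have J: "phi x \<in> J" "k' (phi x) = k x" if "x \<in> F" for x
    using a(1) g_bound[OF that] off(2)[OF that] unfolding phi_def g_def by auto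
  have "inj_on phi {x \<in> F. k x = Zero}"
  proof (rule inj_onI, rule ccontr)
    fix x y assume "x \<in> {x \<in> F. k x = Zero}" "y \<in> {x \<in> F. k x = Zero}" "phi x = phi y" "x \<noteq> y"
    then show False using lt[of x y] lt[of y x] total[of x y] F(2) irr[OF J(1)] by auto
  qed
  then have "wp_hom F lt k J lt' k' phi"
    unfolding wp_hom_def using J lt by (auto simp: lew_def)
  then show ?thesis by blast
qed

text \<open>An alternating type supplies blocks of length 2, \<open>I0\<close> blocks of length 1.
  For \<open>S e\<close> all of \<open>F\<close> goes to one point, which breaks injectivity at
  color 0 exactly when \<open>e = Zero\<close> and \<open>F\<close> has several elements; hence
  \<open>single\<close>.\<close>

lemma chi_type_wp_hom:
  assumes F: "finite F" "F \<subseteq> L" and J: "strict_lin M lt'" "J \<subseteq> M" "J \<noteq> {}" "has_chi_type lt' k' J s"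
    and le: "\<And>x. x \<in> F \<Longrightarrow> chi_le (S (k x)) s"
    and single: "\<And>x y. s = S Zero \<Longrightarrow> x \<in> F \<Longrightarrow> y \<in> F \<Longrightarrow> x = y"
  shows "\<exists>phi. wp_hom F lt k J lt' k' phi"
proof -
  interpret M: strict_lin M lt' by fact
  have irr: "\<And>y. y \<in> J \<Longrightarrow> \<not> lt' y y" using M.irrefl J by blast
  have alt: ?thesis if "type_alt lt' k' J e1 e2" "\<And>x. x \<in> F \<Longrightarrow> k x \<in> {e1, e2}" "e1 \<noteq> e2" for e1 e2
  proof (rule color_chain_wp_hom[OF F, where off = "\<lambda>e. if e = e1 then 0 else 1"])
    show "color_chain lt' k' J (alt2 e1 e2) (2 * (card F + 1))"
      using that(1) unfolding type_alt_iff_chain by blast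
  qed (use that irr in \<open>auto simp: alt2_def\<close>)
  show ?thesis
  proof (cases s)
    case (S e)
    then have k: "k x = e" if "x \<in> F" for x using le[OF that] by (auto simp: chi_le_def)
    obtain y where y: "y \<in> J" using J by blast
    then have "k' y \<in> k' ` J" by blast
    then have "k' y = e" using J(4) S by (simp add: has_chi_type_def)
    then have "wp_hom F lt k J lt' k' (\<lambda>_. y)"
      unfolding wp_hom_def using y k single S by (auto simp: lew_def inj_on_def)
    then show ?thesis by blast
  next
    case I0
    then have inf: "infinite J" "\<And>x. x \<in> J \<Longrightarrow> k' x = Zero" using J(4) by (auto simp: has_chi_type_def)
    have k: "k x = Zero" if "x \<in> F" for x using le[OF that] I0 by (auto simp: chi_le_def)
    show ?thesis
      by (rule color_chain_wp_hom[OF F, where off = "\<lambda>_. 0" and p = 1])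
        (use k irr M.infinite_color_chain[where k = k', OF inf(1) J(2) inf(2)] in auto)
  next
    case IPM
    then show ?thesis using J(4) le by (intro alt[of Pos Neg]) (auto simp: has_chi_type_def chi_le_def)
  next
    case IPZ
    then show ?thesis using J(4) le by (intro alt[of Pos Zero]) (auto simp: has_chi_type_def chi_le_def)
  next
    case IMZ
    then show ?thesis using J(4) le by (intro alt[of Neg Zero]) (auto simp: has_chi_type_def chi_le_def)
  qed
qed

lemma fin_hom_of_inf3:
  assumes "strict_lin M lt'" "type_inf3 lt' k' M"
  shows "fin_hom L lt k M lt' k'"
  unfolding fin_hom_def
proof (intro allI impI, elim conjE)
  interpret M: strict_lin M lt' by fact
  fix F assume F: "finite F" "F \<subseteq> L"
  define off where "off e = (if e = Pos then 0 else if e = Neg then 1 else 2 :: nat)" for e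
  have "off e < 3" "cyc3 (3 * i + off e) = e" for e i
  proof -
    have "(3 * i + 1) mod 3 = 1" "(3 * i + 2) mod 3 = 2" by presburger+
    then show "off e < 3" "cyc3 (3 * i + off e) = e"
      unfolding cyc3_def by (cases e; simp add: off_def)+
  qed
  note off = this
  show "\<exists>phi. wp_hom F lt k M lt' k' phi"
  proof (rule color_chain_wp_hom[OF F, where off = off and p = 3 and c = cyc3])
    show "color_chain lt' k' M cyc3 (3 * (card F + 1))"
      using assms(2) unfolding type_inf3_iff_chain by simp
  qed (rule off, rule off, erule M.irrefl)
qed

text \<open>Consecutive colors of the cycle differ, so a weakly monotone color-preserving map cannot
  identify neighbors of the chain and is strict along all of it.\<close>

lemma inf3_of_fin_hom:
  assumes h: "fin_hom L lt k M lt' k'" and M: "strict_lin M lt'" and inf: "type_inf3 lt k L"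
  shows "type_inf3 lt' k' M"
  unfolding type_inf3_iff_chain
proof
  interpret M: strict_lin M lt' by fact
  fix n
  obtain a where a: "\<forall>i < 3 * (n + 1). a i \<in> L \<and> k (a i) = cyc3 i"
    "\<forall>i j. i < j \<and> j < 3 * (n + 1) \<longrightarrow> lt (a i) (a j)"
    using inf unfolding type_inf3_iff_chain color_chain_def by blast
  have fin: "finite (a ` {..<3 * (n + 1)})" by simp
  have sub: "a ` {..<3 * (n + 1)} \<subseteq> L" using a(1) by auto
  obtain phi where phi: "\<forall>x\<in>a ` {..<3 * (n + 1)}. phi x \<in> M \<and> k' (phi x) = k x"
    "\<forall>x\<in>a ` {..<3 * (n + 1)}. \<forall>y\<in>a ` {..<3 * (n + 1)}. lew lt x y \<longrightarrow> lew lt' (phi x) (phi y)"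
    by (rule fin_homD[OF h fin sub])
  have mono: "lew lt' (phi (a i)) (phi (a j))" if "i \<le> j" "j < 3 * (n + 1)" for i j
    proof -
    have "a i \<in> a ` {..<3 * (n + 1)}" "a j \<in> a ` {..<3 * (n + 1)}" using that by auto
    moreover have "lew lt (a i) (a j)" using that a(2) by (auto simp: lew_def le_less)
    ultimately show ?thesis using phi(2) by blast
  qed
  have M: "phi (a i) \<in> M" "k' (phi (a i)) = cyc3 i" if "i < 3 * (n + 1)" for i
    using that a(1) phi(1) by auto
  have "lt' (phi (a i)) (phi (a j))" if ij: "i < j" "j < 3 * (n + 1)" for i j
  proof -
    have "cyc3 i \<noteq> cyc3 (Suc i)" by (auto simp: cyc3_def mod_Suc split: if_splits)
    then have "phi (a i) \<noteq> phi (a (Suc i))" using M[of i] M[of "Suc i"] ij by auto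
    then have step: "lt' (phi (a i)) (phi (a (Suc i)))" using mono[of i "Suc i"] ij by (simp add: lew_def)
    show ?thesis
    proof (cases "j = Suc i")
      case False
      then have "lt' (phi (a (Suc i))) (phi (a j)) \<or> phi (a (Suc i)) = phi (a j)"
        using mono[of "Suc i" j] ij by (simp add: lew_def)
      then show ?thesis
      proof
        assume "lt' (phi (a (Suc i))) (phi (a j))"
        then show ?thesis using M.trans[OF M(1)[of i] M(1)[of "Suc i"] M(1)[of j] step] ij by simp
      qed (use step in simp)
    qed (use step in simp)
  qed
  then show "color_chain lt' k' M cyc3 (3 * (n + 1))"
    unfolding color_chain_def using M by (intro exI[of _ "\<lambda>i. phi (a i)"]) blast
qed

end

section \<open>Passing between \<chi>-homomorphisms and finite homomorphisms\<close>

lemma chi_le_trans: "chi_le x y \<Longrightarrow> chi_le y z \<Longrightarrow> chi_le x z"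
  by (cases y) (auto simp: chi_le_def)

text \<open>Canonicity of \<open>D\<close> matters only for intervals sent to an interval of type \<open>0\<close>, which has room
  for just one element.\<close>
lemma fin_hom_of_chi_hom:
  assumes L: "strict_lin L lt" and M: "strict_lin M lt'"
    and D: "canonical_decomp L lt k D c" and E: "is_decomp M lt' k' E d"
    and h: "chi_hom D (setlt lt) c E (setlt lt') d h"
  shows "fin_hom L lt k M lt' k'"
  unfolding fin_hom_def
proof (intro allI impI, elim conjE)
  interpret L: strict_lin L lt by fact
  interpret M: strict_lin M lt' by fact
  have dD: "is_decomp L lt k D c" and can: "canonical D (setlt lt) c"
    using D unfolding canonical_decomp_def by simp_all
  interpret D: strict_lin D "setlt lt" by (rule L.decomp_strict_lin[OF dD])
  interpret E: strict_lin E "setlt lt'" by (rule M.decomp_strict_lin[OF E])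
  have hE: "h I \<in> E" "chi_le (c I) (d (h I))" if "I \<in> D" for I
    using h that unfolding chi_hom_def by simp_all
  have hmono: "lew (setlt lt') (h I) (h I')" if "I \<in> D" "I' \<in> D" "setlt lt I I'" for I I'
    using h that unfolding chi_hom_def lew_def by simp
  fix F assume F: "finite F" "F \<subseteq> L"
  have "\<exists>I\<in>D. x \<in> I" if "x \<in> L" for x using L.decomp_basic(2)[OF dD] that by blast
  then obtain cell where cell: "\<And>x. x \<in> L \<Longrightarrow> cell x \<in> D" "\<And>x. x \<in> L \<Longrightarrow> x \<in> cell x" by metis
  have cell_lt: "cell x = cell y \<or> setlt lt (cell x) (cell y)" if "x \<in> L" "y \<in> L" "lt x y" for x y
  proof (rule disjCI)
    assume "\<not> setlt lt (cell x) (cell y)"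
    with that cell show "cell x = cell y" by (meson L.decomp_cells_setlt[OF dD])
  qed
  define G where "G J = {x \<in> F. h (cell x) = J}" for J
  \<comment> \<open>Two cells sent to \<open>J\<close> enclose only cells sent to \<open>J\<close>,
    all of type {0}, and canonicity forbids such a constant stretch by
    \<open>no_constant_interval\<close>. So a single cell is sent to \<open>J\<close>, and it has
    one element.\<close>
  have single: "x = y" if J: "d J = S Zero" "J \<in> E" and xy: "x \<in> G J" "y \<in> G J" for J x y
  proof (rule ccontr)
    assume "x \<noteq> y"
    have *: False if xy: "x \<in> G J" "y \<in> G J" and lt: "lt x y" for x y
    proof -
      have xyL: "x \<in> L" "y \<in> L" and hx: "h (cell x) = J" "h (cell y) = J"
        using xy F unfolding G_def by blast+
      have zero: "c I = S Zero" if "I \<in> D" "h I = J" for I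
        using hE(2)[OF that(1)] that(2) J by (auto simp: chi_le_def)
      have "has_chi_type lt k (cell x) (S Zero)"
        using L.decomp_cell(4)[OF dD cell(1)[OF xyL(1)]] zero[OF cell(1)[OF xyL(1)] hx(1)] by metis
      then have "card (cell x) = 1" by (simp add: has_chi_type_def)
      then obtain u where "cell x = {u}" by (rule card_1_singletonE)
      then have "cell x \<noteq> cell y" using cell(2)[OF xyL(1)] cell(2)[OF xyL(2)] lt L.irrefl[OF xyL(1)] by auto
      then have less: "setlt lt (cell x) (cell y)" using cell_lt[OF xyL lt] by blast
      show False
      proof (rule D.no_constant_interval[OF _ _ cell(1)[OF xyL(1)] cell(1)[OF xyL(2)] less, of c])
        show "finite D" by (rule L.decomp_basic(1)[OF dD])
        show "\<exists>z\<in>D. betw (setlt lt) I I' z" if "I \<in> D" "I' \<in> D" "I \<noteq> I'" "chi_le (c I) (c I')" for I I'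
          using can that unfolding canonical_def by simp
        show "c (cell y) = c (cell x)" using zero cell(1) xyL hx by simp
        fix W assume W: "W \<in> D" "betw (setlt lt) (cell x) (cell y) W"
        then have "setlt lt (cell x) W \<and> setlt lt W (cell y) \<or> setlt lt (cell y) W \<and> setlt lt W (cell x)"
          unfolding betw_def by simp
        then have btw: "setlt lt (cell x) W \<and> setlt lt W (cell y)"
        proof
          assume "setlt lt (cell y) W \<and> setlt lt W (cell x)"
          then have "setlt lt (cell y) (cell x)"
            using D.trans[OF cell(1)[OF xyL(2)] W(1) cell(1)[OF xyL(1)]] by simp
          then show ?thesis using D.asym[OF cell(1)[OF xyL(1)] cell(1)[OF xyL(2)] less] by simp
        qed
        have "lew (setlt lt') J (h W)" "lew (setlt lt') (h W) J"
          using hmono[OF cell(1)[OF xyL(1)] W(1)] hmono[OF W(1) cell(1)[OF xyL(2)]] hx btw by metis+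
        then have "h W = J"
          using E.asym[OF J(2) hE(1)[OF W(1)]] unfolding lew_def by metis
        then show "c W = c (cell x)" using zero W(1) cell(1)[OF xyL(1)] hx by simp
      qed
    qed
    have "x \<in> L" "y \<in> L" using xy F unfolding G_def by blast+
    then show False using *[OF xy] *[OF xy(2,1)] L.total \<open>x \<noteq> y\<close> by blast
  qed
  have "\<exists>phi. wp_hom (G J) lt k J lt' k' phi" if J: "J \<in> E" for J
  proof (rule L.chi_type_wp_hom[OF _ _ M _ _ M.decomp_cell(4)[OF E J]])
    show "finite (G J)" "G J \<subseteq> L" using F unfolding G_def by auto
    show "J \<subseteq> M" "J \<noteq> {}" using M.decomp_cell(1,2)[OF E J] by simp_all
    show "x = y" if "d J = S Zero" "x \<in> G J" "y \<in> G J" for x y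
      using single[OF that(1) J that(2,3)] .
    fix x assume "x \<in> G J"
    then have x: "x \<in> L" "h (cell x) = J" using F unfolding G_def by blast+
    have "chi_le (S (k x)) (c (cell x))"
      by (rule has_chi_type_color[OF L.decomp_cell(4)[OF dD cell(1)[OF x(1)]] cell(2)[OF x(1)]])
    moreover have "chi_le (c (cell x)) (d J)" using hE(2)[OF cell(1)[OF x(1)]] x(2) by simp
    ultimately show "chi_le (S (k x)) (d J)" by (rule chi_le_trans)
  qed
  then obtain f where f: "\<And>J. J \<in> E \<Longrightarrow> wp_hom (G J) lt k J lt' k' (f J)" by metis
  define phi where "phi x = f (h (cell x)) x" for x
  have hc: "h (cell x) \<in> E" "x \<in> G (h (cell x))" if "x \<in> F" for x
    using that F(2) hE(1) cell(1) unfolding G_def by auto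
  have phi: "phi x \<in> h (cell x)" "k' (phi x) = k x" if "x \<in> F" for x
    using f[OF hc(1)[OF that]] hc(2)[OF that] unfolding wp_hom_def phi_def by simp_all
  have phiM: "phi x \<in> M" if "x \<in> F" for x
    using phi(1)[OF that] M.decomp_cell(2)[OF E hc(1)[OF that]] by blast
  have mono: "lew lt' (phi x) (phi y)" if xy: "x \<in> F" "y \<in> F" and "lt x y" for x y
  proof -
    have "h (cell x) = h (cell y) \<or> setlt lt' (h (cell x)) (h (cell y))"
    proof -
      have L: "x \<in> L" "y \<in> L" using xy F(2) by blast+
      have "cell x = cell y \<or> setlt lt (cell x) (cell y)" by (rule cell_lt[OF L \<open>lt x y\<close>])
      then show ?thesis
      proof
        assume "setlt lt (cell x) (cell y)"
        then have "lew (setlt lt') (h (cell x)) (h (cell y))"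
          by (rule hmono[OF cell(1)[OF L(1)] cell(1)[OF L(2)]])
        then show ?thesis unfolding lew_def by (rule disj_comms(1)[THEN iffD1])
      qed simp
    qed
    then show ?thesis
    proof
      assume eq: "h (cell x) = h (cell y)"
      define J where "J = h (cell x)"
      have "J \<in> E" "x \<in> G J" "y \<in> G J" "phi x = f J x" "phi y = f J y"
        using hc(1)[OF xy(1)] hc(2)[OF xy(1)] hc(2)[OF xy(2)] eq unfolding J_def phi_def by simp_all
      moreover from this have "\<forall>u\<in>G J. \<forall>v\<in>G J. lew lt u v \<longrightarrow> lew lt' (f J u) (f J v)"
        using f unfolding wp_hom_def by simp
      moreover have "lew lt x y" using \<open>lt x y\<close> unfolding lew_def by simp
      ultimately show ?thesis by simp
    next
      assume "setlt lt' (h (cell x)) (h (cell y))"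
      then show ?thesis using phi(1) xy unfolding setlt_def lew_def by blast
    qed
  qed
  have "x = y" if xy: "x \<in> F" "y \<in> F" "k x = Zero" "k y = Zero" "phi x = phi y" for x y
  proof -
    have eq: "h (cell x) = h (cell y)"
      using M.decomp_basic(3)[OF E hc(1)[OF xy(1)] hc(1)[OF xy(2)]] phi(1)[OF xy(1)] phi(1)[OF xy(2)] xy(5) by auto
    have "inj_on (f (h (cell x))) {z \<in> G (h (cell x)). k z = Zero}"
      using f[OF hc(1)[OF xy(1)]] unfolding wp_hom_def by simp
    then show ?thesis
      using hc(2)[OF xy(1)] hc(2)[OF xy(2)] xy eq unfolding phi_def inj_on_def by simp
  qed
  then have "wp_hom F lt k M lt' k' phi"
    unfolding wp_hom_def inj_on_def using phiM phi(2) mono by (auto simp: lew_def)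
  then show "\<exists>phi. wp_hom F lt k M lt' k' phi" by blast
qed


lemma pigeonhole_less:
  fixes f :: "nat \<Rightarrow> 'a"
  assumes "finite X" "\<And>i. i \<le> card X \<Longrightarrow> f i \<in> X"
  obtains i j where "i < j" "j \<le> card X" "f i = f j"
proof -
  have "card (f ` {..card X}) \<le> card X" by (rule card_mono[OF assms(1)], rule image_subsetI) (simp add: assms(2))
  then have "\<not> inj_on f {..card X}" by (intro pigeonhole) simp
  then obtain i j where "i \<le> card X" "j \<le> card X" "i \<noteq> j" "f i = f j" unfolding inj_on_def by auto
  then show thesis using that[of i j] that[of j i] by (cases "i < j") auto
qed

text \<open>A finite part of \<open>I\<close> large compared with the number of intervals in \<open>E\<close> forces two of its
  elements into the same interval, which must then have at least the type of \<open>I\<close>.\<close>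
lemma interval_test_set:
  assumes M: "strict_lin M lt'" and E: "is_decomp M lt' k' E d"
    and I: "I \<noteq> {}" "has_chi_type lt k I t"
  shows "\<exists>F. finite F \<and> F \<subseteq> I \<and> (\<forall>phi. (\<forall>x\<in>F. phi x \<in> M \<and> k' (phi x) = k x) \<and>
      (\<forall>x\<in>F. \<forall>y\<in>F. lew lt x y \<longrightarrow> lew lt' (phi x) (phi y)) \<and>
      (\<forall>x\<in>F. \<forall>y\<in>F. k x = Zero \<longrightarrow> phi x = phi y \<longrightarrow> x = y) \<longrightarrow>
      (\<exists>J\<in>E. \<exists>x\<in>F. phi x \<in> J \<and> chi_le t (d J)))"
proof -
  interpret M: strict_lin M lt' by fact
  have finE: "finite E" by (rule M.decomp_basic(1)[OF E])
  have ex: "\<exists>J\<in>E. y \<in> J" if "y \<in> M" for y using M.decomp_basic(2)[OF E] that by auto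
  define cell where "cell y = (SOME J. J \<in> E \<and> y \<in> J)" for y
  have cell: "cell y \<in> E" "y \<in> cell y" if "y \<in> M" for y
    using someI_ex[of "\<lambda>J. J \<in> E \<and> y \<in> J"] ex[OF that] unfolding cell_def by auto
  have color: "chi_le (S (k' y)) (d J)" if "J \<in> E" "y \<in> J" for J y
    by (rule has_chi_type_color[OF M.decomp_cell(4)[OF E that(1)] that(2)])
  have alt: ?thesis if "type_alt lt k I e1 e2"
    and le: "\<And>s. chi_le (S e1) s \<Longrightarrow> chi_le (S e2) s \<Longrightarrow> chi_le t s" for e1 e2
  proof -
    define n where "n = card E"
    obtain a where a: "\<forall>i < 2 * (n + 1). a i \<in> I \<and> k (a i) = alt2 e1 e2 i"
      "\<forall>i j. i < j \<and> j < 2 * (n + 1) \<longrightarrow> lt (a i) (a j)"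
      using \<open>type_alt lt k I e1 e2\<close> unfolding type_alt_iff_chain color_chain_def by blast
    show ?thesis
    proof (intro exI[of _ "a ` {..<2 * (n + 1)}"] conjI allI impI; (elim conjE)?)
      fix phi
      assume phi: "\<forall>x\<in>a ` {..<2 * (n + 1)}. phi x \<in> M \<and> k' (phi x) = k x"
        "\<forall>x\<in>a ` {..<2 * (n + 1)}. \<forall>y\<in>a ` {..<2 * (n + 1)}. lew lt x y \<longrightarrow> lew lt' (phi x) (phi y)"
      define b where "b i = phi (a i)" for i
      have b: "b i \<in> M" "k' (b i) = alt2 e1 e2 i" if "i < 2 * (n + 1)" for i
        using phi(1) a(1) that unfolding b_def by auto
      have b_mono: "lew lt' (b i) (b j)" if "i < j" "j < 2 * (n + 1)" for i j
        using phi(2) a(2) that unfolding b_def by (auto simp: lew_def)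
      \<comment> \<open>Length \<open>2 * (n + 1)\<close> gives \<open>card E + 1\<close> even
        positions, so two of them share a cell. By convexity this cell also contains an odd position
        in between, hence both colors.\<close>
      have "cell (b (2 * i)) \<in> E" if "i \<le> card E" for i
        using cell(1) b(1)[of "2 * i"] that unfolding n_def by simp
      then obtain i j where ij: "i < j" "j \<le> n" "cell (b (2 * i)) = cell (b (2 * j))"
        using pigeonhole_less[OF finE, of "\<lambda>i. cell (b (2 * i))"] unfolding n_def by metis
      define J where "J = cell (b (2 * i))"
      have J: "J \<in> E" "b (2 * i) \<in> J" "b (2 * j) \<in> J"
        using cell[OF b(1)[of "2 * i"]] cell[OF b(1)[of "2 * j"]] ij unfolding J_def by auto
      have "lew lt' (b (2 * i)) (b (2 * i + 1))" "lew lt' (b (2 * i + 1)) (b (2 * j))"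
        by (rule b_mono; use ij in simp)+
      moreover have "b (2 * i + 1) \<in> M" using b ij by simp
      ultimately have mid: "b (2 * i + 1) \<in> J"
        using M.decomp_cell(3)[OF E J(1)] J(2,3) unfolding convex_in_def lew_def by metis
      have "k' (b (2 * i)) = e1" "k' (b (2 * i + 1)) = e2"
        using b(2)[of "2 * i"] b(2)[of "2 * i + 1"] ij by (simp_all add: alt2_def)
      then have "chi_le t (d J)" using le color[OF J(1,2)] color[OF J(1) mid] by simp
      then show "\<exists>J\<in>E. \<exists>x\<in>a ` {..<2 * (n + 1)}. phi x \<in> J \<and> chi_le t (d J)"
        using J ij unfolding b_def by (intro bexI[of _ J] bexI[of _ "a (2 * i)"]) auto
    qed (use a(1) in auto)
  qed
  show ?thesis
  proof (cases t)
    case (S e)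
    obtain x where x: "x \<in> I" using I(1) by blast
    then have "k x \<in> k ` I" by blast
    then have kx: "k x = e" using I(2) S by (simp add: has_chi_type_def)
    show ?thesis
    proof (intro exI[of _ "{x}"] conjI allI impI; (elim conjE)?)
      fix phi assume "\<forall>x\<in>{x}. phi x \<in> M \<and> k' (phi x) = k x"
      then have "phi x \<in> M" "k' (phi x) = e" using kx by simp_all
      then show "\<exists>J\<in>E. \<exists>x\<in>{x}. phi x \<in> J \<and> chi_le t (d J)"
        using cell[of "phi x"] color[of "cell (phi x)" "phi x"] S by auto
    qed (use x in auto)
  next
    case I0
    then have inf: "infinite I" "k ` I = {Zero}" using I(2) by (simp_all add: has_chi_type_def)
    \<comment> \<open>One more point than there are cells: injectivity at color 0 keeps the images
      distinct, so two of them share a cell, which cannot be of type {0}.\<close>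
    obtain F where F: "F \<subseteq> I" "finite F" "card F = Suc (card E)"
      using infinite_arbitrarily_large[OF inf(1)] by blast
    have kF: "k x = Zero" if "x \<in> F" for x
    proof -
      have "k x \<in> k ` I" using that F by blast
      then show ?thesis using inf(2) by simp
    qed
    show ?thesis
    proof (intro exI[of _ F] conjI allI impI F; (elim conjE)?)
      fix phi
      assume phi: "\<forall>x\<in>F. phi x \<in> M \<and> k' (phi x) = k x"
        "\<forall>x\<in>F. \<forall>y\<in>F. k x = Zero \<longrightarrow> phi x = phi y \<longrightarrow> x = y"
      have "(\<lambda>x. cell (phi x)) ` F \<subseteq> E" using cell(1) phi(1) by blast
      then have "card ((\<lambda>x. cell (phi x)) ` F) < card F" using card_mono[OF finE] F(3) by (simp add: le_imp_less_Suc)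
      then have "\<not> inj_on (\<lambda>x. cell (phi x)) F" by (rule pigeonhole)
      then obtain x y where xy: "x \<in> F" "y \<in> F" "x \<noteq> y" "cell (phi x) = cell (phi y)"
        unfolding inj_on_def by blast
      define J where "J = cell (phi x)"
      have J: "J \<in> E" "phi x \<in> J" "phi y \<in> J" using cell[of "phi x"] cell[of "phi y"] phi(1) xy unfolding J_def by auto
      have ne: "phi x \<noteq> phi y" using phi(2) xy kF by blast
      have "d J \<noteq> S Zero"
      proof
        assume "d J = S Zero"
        then have "card J = 1" using M.decomp_cell(4)[OF E J(1)] by (simp add: has_chi_type_def)
        then obtain u where "J = {u}" by (rule card_1_singletonE)
        then show False using J ne by simp
      qed
      moreover have "chi_le (S Zero) (d J)" using color[OF J(1,2)] phi(1) xy kF by simp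
      ultimately have "chi_le t (d J)" using I0 by (cases "d J") (simp_all add: chi_le_def)
      then show "\<exists>J\<in>E. \<exists>x\<in>F. phi x \<in> J \<and> chi_le t (d J)" using J xy by blast
    qed
  next
    case IPM
    show ?thesis
    proof (rule alt[of Pos Neg])
      show "chi_le t s" if "chi_le (S Pos) s" "chi_le (S Neg) s" for s
        using that IPM by (cases s) (simp_all add: chi_le_def)
    qed (use I(2) IPM in \<open>simp add: has_chi_type_def\<close>)
  next
    case IPZ
    show ?thesis
    proof (rule alt[of Pos Zero])
      show "chi_le t s" if "chi_le (S Pos) s" "chi_le (S Zero) s" for s
        using that IPZ by (cases s) (simp_all add: chi_le_def)
    qed (use I(2) IPZ in \<open>simp add: has_chi_type_def\<close>)
  next
    case IMZ
    show ?thesis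
    proof (rule alt[of Neg Zero])
      show "chi_le t s" if "chi_le (S Neg) s" "chi_le (S Zero) s" for s
        using that IMZ by (cases s) (simp_all add: chi_le_def)
    qed (use I(2) IMZ in \<open>simp add: has_chi_type_def\<close>)
  qed
qed

lemma chi_hom_of_fin_hom:
  assumes L: "strict_lin L lt" and M: "strict_lin M lt'" and h: "fin_hom L lt k M lt' k'"
    and D: "is_decomp L lt k D c" and E: "is_decomp M lt' k' E d"
  shows "\<exists>f. chi_hom D (setlt lt) c E (setlt lt') d f"
proof -
  interpret L: strict_lin L lt by fact
  interpret M: strict_lin M lt' by fact
  define test where "test I F \<longleftrightarrow> finite F \<and> F \<subseteq> I \<and> (\<forall>phi. (\<forall>x\<in>F. phi x \<in> M \<and> k' (phi x) = k x) \<and>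
      (\<forall>x\<in>F. \<forall>y\<in>F. lew lt x y \<longrightarrow> lew lt' (phi x) (phi y)) \<and>
      (\<forall>x\<in>F. \<forall>y\<in>F. k x = Zero \<longrightarrow> phi x = phi y \<longrightarrow> x = y) \<longrightarrow>
      (\<exists>J\<in>E. \<exists>x\<in>F. phi x \<in> J \<and> chi_le (c I) (d J)))" for I F
  have "\<exists>F. test I F" if "I \<in> D" for I
    unfolding test_def
    by (rule interval_test_set[OF M E L.decomp_cell(1)[OF D that] L.decomp_cell(4)[OF D that]])
  then obtain F where test: "\<And>I. I \<in> D \<Longrightarrow> test I (F I)" by metis
  then have F: "\<And>I. I \<in> D \<Longrightarrow> finite (F I)" "\<And>I. I \<in> D \<Longrightarrow> F I \<subseteq> I"
    unfolding test_def by blast+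
  \<comment> \<open>The test sets were fixed before any map was chosen, so a single
    \<open>phi\<close> on their finite union serves all intervals at once.\<close>
  have fin: "finite (\<Union>(F ` D))" using F(1) L.decomp_basic(1)[OF D] by simp
  have sub: "\<Union>(F ` D) \<subseteq> L" using F(2) L.decomp_basic(2)[OF D] by auto
  obtain phi where phi: "\<forall>x\<in>\<Union>(F ` D). phi x \<in> M \<and> k' (phi x) = k x"
    "\<forall>x\<in>\<Union>(F ` D). \<forall>y\<in>\<Union>(F ` D). lew lt x y \<longrightarrow> lew lt' (phi x) (phi y)"
    "\<forall>x\<in>\<Union>(F ` D). \<forall>y\<in>\<Union>(F ` D). k x = Zero \<longrightarrow> phi x = phi y \<longrightarrow> x = y"
    by (rule fin_homD[OF h fin sub])
  have "\<exists>J x. J \<in> E \<and> x \<in> F I \<and> phi x \<in> J \<and> chi_le (c I) (d J)" if I: "I \<in> D" for I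
  proof -
    have m: "x \<in> \<Union>(F ` D)" if "x \<in> F I" for x using that I by blast
    have "\<forall>x\<in>F I. phi x \<in> M \<and> k' (phi x) = k x"
      "\<forall>x\<in>F I. \<forall>y\<in>F I. lew lt x y \<longrightarrow> lew lt' (phi x) (phi y)"
      "\<forall>x\<in>F I. \<forall>y\<in>F I. k x = Zero \<longrightarrow> phi x = phi y \<longrightarrow> x = y"
      using phi m by metis+
    then have "\<exists>J\<in>E. \<exists>x\<in>F I. phi x \<in> J \<and> chi_le (c I) (d J)"
      using test[OF I] unfolding test_def by simp
    then show ?thesis by blast
  qed
  then obtain f x where f: "\<And>I. I \<in> D \<Longrightarrow> f I \<in> E" "\<And>I. I \<in> D \<Longrightarrow> x I \<in> F I"
      "\<And>I. I \<in> D \<Longrightarrow> phi (x I) \<in> f I" "\<And>I. I \<in> D \<Longrightarrow> chi_le (c I) (d (f I))"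
    by metis
  \<comment> \<open>\<open>f I\<close> was chosen together with a point \<open>x I\<close> that
    \<open>phi\<close> sends into it. Distinct cells are ordered like any pair of their points, so
    monotonicity passes from \<open>phi\<close> to \<open>f\<close>.\<close>
  have "lew (setlt lt') (f I) (f I')" if I: "I \<in> D" "I' \<in> D" "setlt lt I I'" for I I'
  proof -
    have "lt (x I) (x I')" using I(3) f(2)[OF I(1)] f(2)[OF I(2)] F(2)[OF I(1)] F(2)[OF I(2)]
      unfolding setlt_def by blast
    then have le: "lew lt' (phi (x I)) (phi (x I'))"
      using phi(2) f(2) I unfolding lew_def by blast
    show ?thesis
    proof (cases "f I = f I'")
      case False
      then have "phi (x I) \<noteq> phi (x I')"
        using M.decomp_basic(3)[OF E f(1)[OF I(1)] f(1)[OF I(2)]] f(3)[OF I(1)] f(3)[OF I(2)] by auto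
      then have "lt' (phi (x I)) (phi (x I'))" using le by (simp add: lew_def)
      then show ?thesis
        using M.decomp_cells_setlt[OF E f(1)[OF I(1)] f(1)[OF I(2)] False f(3)[OF I(1)] f(3)[OF I(2)]]
        by (simp add: lew_def)
    qed (simp add: lew_def)
  qed
  then have "chi_hom D (setlt lt) c E (setlt lt') d f"
    unfolding chi_hom_def using f(1,4) by (auto simp: lew_def)
  then show ?thesis by blast
qed

section \<open>Orbitals\<close>

lemma aut_less: "aut g \<Longrightarrow> g x < g y \<longleftrightarrow> x < y"
  unfolding aut_def by (simp add: strict_mono_less)

lemma aut_le: "aut g \<Longrightarrow> g x \<le> g y \<longleftrightarrow> x \<le> y"
  unfolding aut_def by (simp add: strict_mono_less_eq)

lemma aut_inv_right: "aut g \<Longrightarrow> g (inv g x) = x"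
  unfolding aut_def by (simp add: bij_is_surj surj_f_inv_f)

lemma aut_inv_left: "aut g \<Longrightarrow> inv g (g x) = x"
  unfolding aut_def by (simp add: bij_is_inj)

lemma aut_inv: "aut g \<Longrightarrow> aut (inv g)"
proof -
  assume g: "aut g"
  have "inv g x < inv g y" if "x < y" for x y
    using that aut_less[OF g, of "inv g x" "inv g y"] aut_inv_right[OF g] by simp
  then have "strict_mono (inv g)" by (rule strict_monoI)
  moreover have "bij (inv g)" using g unfolding aut_def by (simp add: bij_imp_bij_inv)
  ultimately show ?thesis unfolding aut_def by simp
qed

lemma aut_inv_inv: "aut g \<Longrightarrow> inv (inv g) = g"
  unfolding aut_def by (simp add: inv_inv_eq)

lemma autI: "strict_mono g \<Longrightarrow> surj g \<Longrightarrow> aut g"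
  unfolding aut_def bij_def by (simp add: strict_mono_imp_inj_on)

lemma aut_comp: "aut f \<Longrightarrow> aut g \<Longrightarrow> aut (f \<circ> g)"
  unfolding aut_def by (simp add: bij_comp strict_mono_def)

section \<open>Integer powers and the orbitals they span\<close>

lemma ipow_0 [simp]: "ipow g 0 x = x"
  unfolding ipow_def by simp

lemma ipow_1 [simp]: "ipow g 1 x = g x"
  unfolding ipow_def by simp

lemma ipow_Suc:
  assumes "aut g"
  shows "ipow g (n + 1) x = g (ipow g n x)"
proof (cases "0 \<le> n")
  case True
  then have "nat (n + 1) = Suc (nat n)" by simp
  then show ?thesis using True unfolding ipow_def by simp
next
  case False
  define m where "m = nat (- (n + 1))"
  have n: "nat (- n) = Suc m" using False unfolding m_def by simp
  have "ipow g (n + 1) x = (inv g ^^ m) x"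
    using False unfolding ipow_def m_def by auto
  moreover have "ipow g n x = inv g ((inv g ^^ m) x)"
    using False n unfolding ipow_def by simp
  ultimately show ?thesis using aut_inv_right[OF assms] by simp
qed

lemma ipow_pred:
  assumes "aut g"
  shows "ipow g (n - 1) x = inv g (ipow g n x)"
  using ipow_Suc[OF assms, of "n - 1" x] aut_inv_left[OF assms] by simp

lemma ipow_add:
  assumes "aut g"
  shows "ipow g (m + n) x = ipow g m (ipow g n x)"
proof (induction m rule: int_induct[where k = 0])
  case base show ?case by simp
next
  case (step1 m)
  have "ipow g (m + 1 + n) x = ipow g ((m + n) + 1) x" by (simp add: add_ac)
  then show ?case using step1 ipow_Suc[OF assms] by simp
next
  case (step2 m)
  have "ipow g (m - 1 + n) x = ipow g ((m + n) - 1) x" by (simp add: algebra_simps)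
  then show ?case using step2 ipow_pred[OF assms] by simp
qed

lemma ipow_le:
  assumes "aut g"
  shows "ipow g n x \<le> ipow g n y \<longleftrightarrow> x \<le> y"
proof (induction n rule: int_induct[where k = 0])
  case base show ?case by simp
next
  case (step1 m) then show ?case by (simp add: ipow_Suc assms aut_le)
next
  case (step2 m) then show ?case by (simp add: ipow_pred assms aut_le aut_inv)
qed

lemma ipow_cancel: "aut g \<Longrightarrow> ipow g (- n) (ipow g n x) = x"
  by (simp add: ipow_add[symmetric])

lemma ipow_inv:
  assumes "aut g"
  shows "ipow (inv g) n x = ipow g (- n) x"
  by (cases "n = 0"; cases "0 \<le> n") (simp_all add: ipow_def aut_inv_inv[OF assms])

lemma ipow_fixed:
  assumes "aut g" "g x = x"
  shows "ipow g n x = x"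
proof (induction n rule: int_induct[where k = 0])
  case base show ?case by simp
next
  case (step1 m) then show ?case by (simp add: ipow_Suc assms)
next
  case (step2 m) then show ?case using aut_inv_left[OF assms(1), of x] assms(2) by (simp add: ipow_pred assms(1))
qed

text \<open>Reduces decreasing orbitals to increasing ones by passing to the inverse.\<close>

lemma orbital_inv:
  assumes "aut g"
  shows "orbital (inv g) x = orbital g x"
  unfolding orbital_def ipow_inv[OF assms] by (metis minus_minus)

lemma orbital_self: "x \<in> orbital g x"
  unfolding orbital_def by (intro CollectI exI[of _ 0]) simp

lemma orbital_image:
  assumes "aut g"
  shows "g x \<in> orbital g x"
  unfolding orbital_def by (intro CollectI exI[of _ 1]) simp

lemma orbital_sym:
  assumes "aut g" "q \<in> orbital g x"
  shows "x \<in> orbital g q"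
proof -
  obtain m n where mn: "ipow g n x \<le> q" "q \<le> ipow g m x" using assms(2) unfolding orbital_def by blast
  have "x \<le> ipow g (- n) q" using mn(1) ipow_le[OF assms(1), of "- n" "ipow g n x" q] ipow_cancel[OF assms(1)] by simp
  moreover have "ipow g (- m) q \<le> x" using mn(2) ipow_le[OF assms(1), of "- m" q "ipow g m x"] ipow_cancel[OF assms(1)] by simp
  ultimately show ?thesis unfolding orbital_def by blast
qed

lemma orbital_trans:
  assumes "aut g" "q \<in> orbital g x" "r \<in> orbital g q"
  shows "r \<in> orbital g x"
proof -
  obtain m n where mn: "ipow g n x \<le> q" "q \<le> ipow g m x" using assms(2) unfolding orbital_def by blast
  obtain i j where ij: "ipow g i q \<le> r" "r \<le> ipow g j q" using assms(3) unfolding orbital_def by blast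
  have "ipow g (i + n) x \<le> r"
    using mn(1) ij(1) ipow_le[OF assms(1), of i "ipow g n x" q] by (simp add: ipow_add assms(1))
  moreover have "r \<le> ipow g (j + m) x"
    using mn(2) ij(2) ipow_le[OF assms(1), of j q "ipow g m x"] by (simp add: ipow_add assms(1))
  ultimately show ?thesis unfolding orbital_def by blast
qed

lemma orbital_eq:
  assumes "aut g" "q \<in> orbital g x"
  shows "orbital g q = orbital g x"
  using orbital_trans[OF assms(1)] orbital_sym[OF assms] assms(2) by blast

lemma orbital_convex:
  assumes "a \<in> orbital g x" "b \<in> orbital g x" "a \<le> c" "c \<le> b"
  shows "c \<in> orbital g x"
  using assms unfolding orbital_def by (blast intro: order_trans)

lemma orbital_inv_image:
  assumes "aut g"
  shows "inv g x \<in> orbital g x"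
  using orbital_image[OF aut_inv[OF assms]] orbital_inv[OF assms] by simp

lemma orbital_fixed:
  assumes "aut g" "g x = x"
  shows "orbital g x = {x}"
  unfolding orbital_def ipow_fixed[OF assms] by auto

text \<open>If \<open>g q \<le> q\<close>, forward iterates of \<open>q\<close> only fall while
  those of \<open>x\<close> only rise. The lower bound on \<open>q\<close> then gives
  \<open>x \<le> q\<close>, and the upper bound forces \<open>q\<close> to be an iterate of
  \<open>x\<close>, where \<open>g\<close> moves strictly up.\<close>

lemma orbital_increasing:
  assumes g: "aut g" and x: "x < g x" and q: "q \<in> orbital g x"
  shows "q < g q"
proof (rule ccontr)
  assume "\<not> q < g q"
  then have gq: "g q \<le> q" by simp
  have up: "x \<le> ipow g (int k) x" for k
  proof (induction k)
    case (Suc k)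
    then have "g x \<le> g (ipow g (int k) x)" using aut_le[OF g] by simp
    then have "x \<le> g (ipow g (int k) x)" using x by simp
    then show ?case using ipow_Suc[OF g, of "int k" x] by (simp add: add.commute)
  qed simp
  have down: "ipow g (int k) q \<le> q" for k
  proof (induction k)
    case (Suc k)
    then have "g (ipow g (int k) q) \<le> g q" using aut_le[OF g] by simp
    then have "g (ipow g (int k) q) \<le> q" using gq by simp
    then show ?case using ipow_Suc[OF g, of "int k" q] by (simp add: add.commute)
  qed simp
  obtain m n where mn: "ipow g n x \<le> q" "q \<le> ipow g m x" using q unfolding orbital_def by blast
  have shift: "ipow g (- int k) y \<le> z \<longleftrightarrow> y \<le> ipow g (int k) z" for k y z
    using ipow_le[OF g, of "int k" "ipow g (- int k) y" z] ipow_cancel[OF g, of "- int k" y] by simp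
  have "x \<le> q"
  proof (cases n)
    case (nonneg k) then show ?thesis using mn(1) up[of k] by simp
  next
    case (neg k) then show ?thesis using mn(1) shift[of "Suc k" x q] down[of "Suc k"] by simp
  qed
  have "q = ipow g m x"
  proof (cases m)
    case (nonneg k)
    have "ipow g m x \<le> ipow g m q" using ipow_le[OF g] \<open>x \<le> q\<close> by simp
    then show ?thesis using mn(2) down[of k] nonneg by simp
  next
    case (neg k)
    have "ipow g (- int (Suc k)) x \<le> x" using shift[of "Suc k" x x] up[of "Suc k"] by blast
    then have "q \<le> x" using mn(2) neg by simp
    then have "x = q" using \<open>x \<le> q\<close> by simp
    then show ?thesis using gq x by simp
  qed
  moreover have "ipow g m x < ipow g m (g x)" using x ipow_le[OF g, of m "g x" x] by (simp add: not_le[symmetric])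
  moreover have "ipow g m (g x) = g (ipow g m x)"
    using ipow_add[OF g, of m 1 x] ipow_Suc[OF g, of m x] by simp
  ultimately show False using gq by simp
qed

lemma orbital_par:
  assumes g: "aut g" and q: "q \<in> orbital g x"
  shows "par g q = par g x"
proof -
  consider "x < g x" | "g x = x" | "g x < x" by fastforce
  then show ?thesis
  proof cases
    case 1
    then show ?thesis using orbital_increasing[OF g 1 q] by (simp add: par_def sgnc_def)
  next
    case 2
    then show ?thesis using q orbital_fixed[OF g 2] by simp
  next
    case 3
    then have "x < inv g x" using aut_less[OF aut_inv[OF g], of "g x" x] aut_inv_left[OF g] by simp
    then have "q < inv g q" using orbital_increasing[OF aut_inv[OF g]] q orbital_inv[OF g] by simp
    then have "g q < q" using aut_less[OF g, of q "inv g q"] aut_inv_right[OF g] by simp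
    then show ?thesis using 3 by (simp add: par_def sgnc_def)
  qed
qed

lemma orbcol_orbital:
  assumes "aut g"
  shows "orbcol g (orbital g x) = par g x"
proof -
  have "(SOME y. y \<in> orbital g x) \<in> orbital g x" using orbital_self by (rule someI)
  then show ?thesis unfolding orbcol_def using orbital_par[OF assms] by blast
qed

lemma par_Pos: "par g x = Pos \<longleftrightarrow> x < g x"
  and par_Zero: "par g x = Zero \<longleftrightarrow> g x = x"
  and par_Neg: "par g x = Neg \<longleftrightarrow> g x < x"
  by (auto simp: par_def sgnc_def)

text \<open>An inversion \<open>v \<le> u\<close> would, by convexity, put \<open>y\<close> into the
  orbital of \<open>x\<close> or \<open>u\<close> into the orbital of \<open>y\<close>, and orbitals
  that meet coincide.\<close>

lemma orbital_prec:
  assumes g: "aut g" and "x < y" "orbital g x \<noteq> orbital g y"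
  shows "prec (orbital g x) (orbital g y)"
  unfolding setlt_def
proof (intro ballI)
  fix u v assume uv: "u \<in> orbital g x" "v \<in> orbital g y"
  show "u < v"
  proof (rule ccontr)
    assume "\<not> u < v"
    have "y \<in> orbital g x \<or> u \<in> orbital g y"
    proof (cases "y \<le> u")
      case True
      then show ?thesis using orbital_convex[OF orbital_self uv(1), of y] assms(2) by simp
    next
      case False
      then show ?thesis using orbital_convex[OF uv(2) orbital_self, of u] \<open>\<not> u < v\<close> by simp
    qed
    then show False using orbital_eq[OF g] uv assms(3) by metis
  qed
qed

lemma strict_lin_orbitals:
  assumes g: "aut g"
  shows "strict_lin (orbitals g) prec"
proof
  fix I assume "I \<in> orbitals g"
  then obtain x where "I = orbital g x" unfolding orbitals_def by blast
  then show "\<not> prec I I" using orbital_self unfolding setlt_def by blast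
next
  fix I J K assume *: "J \<in> orbitals g" "prec I J" "prec J K"
  then obtain y where "J = orbital g y" unfolding orbitals_def by blast
  then have "y \<in> J" using orbital_self by simp
  then show "prec I K" using * unfolding setlt_def by (meson order_less_trans)
next
  fix I J assume "I \<in> orbitals g" "J \<in> orbitals g" "I \<noteq> J"
  then obtain x y where xy: "I = orbital g x" "J = orbital g y" "x \<noteq> y" unfolding orbitals_def by blast
  then show "prec I J \<or> prec J I"
    using orbital_prec[OF g, of x y] orbital_prec[OF g, of y x] \<open>I \<noteq> J\<close> by (cases "x < y") auto
qed

text \<open>Supplies the density that \<open>ex_canonical_decomp\<close> asks for; it comes from the
  density of the rationals, as orbitals of color 0 are single points.\<close>

lemma orbitals_Zero_dense:
  assumes g: "aut g" and IJ: "I \<in> orbitals g" "J \<in> orbitals g" "orbcol g I = Zero" "orbcol g J = Zero" "prec I J"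
  shows "\<exists>K\<in>orbitals g. prec I K \<and> prec K J"
proof -
  obtain x y where xy: "I = orbital g x" "J = orbital g y" using IJ unfolding orbitals_def by blast
  have I: "I = {x}" "J = {y}" using IJ xy orbcol_orbital[OF g] orbital_fixed[OF g] by (simp_all add: par_Zero)
  then have lt: "x < y" using IJ unfolding setlt_def by simp
  define z where "z = (x + y) / 2"
  have z: "x < z" "z < y" using lt unfolding z_def by simp_all
  have "orbital g z \<noteq> I" "orbital g z \<noteq> J" using z I orbital_self[of z g] by auto
  then show ?thesis
    using orbital_prec[OF g z(1)] orbital_prec[OF g z(2)] xy unfolding orbitals_def by auto
qed

section \<open>Partial conjugations\<close>

text \<open>Points are added in increasing order, so only the part beyond the previous maximum
  \<open>m\<close> is redefined. There the line through \<open>(m, t m)\<close> and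
  \<open>(b, t b)\<close>, of positive rational slope, continues the old automorphism and keeps it
  onto.\<close>

lemma extend_finite_strict_mono:
  fixes t :: "rat \<Rightarrow> rat"
  assumes "finite X" "strict_mono_on X t"
  shows "\<exists>\<sigma>. aut \<sigma> \<and> (\<forall>x\<in>X. \<sigma> x = t x)"
  using assms
proof (induction X rule: finite_linorder_max_induct)
  case empty
  have "aut id" unfolding aut_def by (simp add: strict_mono_def)
  then show ?case by blast
next
  case (insert b X)
  have "strict_mono_on X t" by (rule monotone_on_subset[OF insert.prems]) auto
  then obtain \<sigma> where \<sigma>: "aut \<sigma>" "\<forall>x\<in>X. \<sigma> x = t x" using insert.IH by blast
  show ?case
  proof (cases "X = {}")
    case True
    have "strict_mono (\<lambda>x. x + (t b - b))" by (simp add: strict_mono_def)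
    moreover have "surj (\<lambda>x. x + (t b - b))" by (rule surjI[of _ "\<lambda>y. y - (t b - b)"]) simp
    ultimately have "aut (\<lambda>x. x + (t b - b))" by (rule autI)
    then show ?thesis using True by (intro exI[of _ "\<lambda>x. x + (t b - b)"]) simp
  next
    case False
    define m where "m = Max X"
    have m: "m \<in> X" "\<And>x. x \<in> X \<Longrightarrow> x \<le> m" using False insert.hyps unfolding m_def by simp_all
    have mb: "m < b" using insert.hyps m by blast
    have "t m < t b" using insert.prems m mb by (auto intro: strict_mono_onD)
    define d where "d = (t b - t m) / (b - m)"
    have d: "d > 0" using mb \<open>t m < t b\<close> unfolding d_def by simp
    define \<tau> where "\<tau> x = (if x \<le> m then \<sigma> x else t m + (x - m) * d)" for x
    have sm: "\<sigma> m = t m" using \<sigma> m by blast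
    have "\<tau> x < \<tau> y" if "x < y" for x y
    proof (cases "y \<le> m")
      case True then show ?thesis using that aut_less[OF \<sigma>(1)] unfolding \<tau>_def by simp
    next
      case y: False
      show ?thesis
      proof (cases "x \<le> m")
        case True
        have "\<sigma> x \<le> t m" using aut_le[OF \<sigma>(1), of x m] True sm by simp
        also have "\<dots> < t m + (y - m) * d" using y d by simp
        finally show ?thesis using True y unfolding \<tau>_def by simp
      next
        case False
        then show ?thesis using y that d unfolding \<tau>_def by simp
      qed
    qed
    then have "strict_mono \<tau>" by (rule strict_monoI)
    moreover have "surj \<tau>"
    proof (rule surjI)
      fix y
      show "\<tau> (if y \<le> t m then inv \<sigma> y else m + (y - t m) / d) = y"
      proof (cases "y \<le> t m")
        case True
        have "inv \<sigma> y \<le> m" using aut_le[OF \<sigma>(1), of "inv \<sigma> y" m] aut_inv_right[OF \<sigma>(1)] sm True by simp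
        then show ?thesis using True aut_inv_right[OF \<sigma>(1)] unfolding \<tau>_def by simp
      next
        case False
        define e where "e = (y - t m) / d"
        have "e > 0" "e * d = y - t m" using False d unfolding e_def by simp_all
        then show ?thesis using False unfolding \<tau>_def e_def[symmetric] by simp
      qed
    qed
    ultimately have "aut \<tau>" by (rule autI)
    moreover have "\<tau> x = t x" if "x \<in> X" for x using that m \<sigma> unfolding \<tau>_def by simp
    moreover have "\<tau> b = t b" using mb unfolding \<tau>_def d_def by simp
    ultimately show ?thesis by (intro exI[of _ \<tau>]) simp
  qed
qed

text \<open>\<open>C\<close> contains a point above all of \<open>P\<close> and a point below all of
  \<open>Q\<close>. If neither fits, they straddle the gap from \<open>Max P\<close> to
  \<open>Min Q\<close>, whose midpoint then lies in \<open>C\<close> by convexity.\<close>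

lemma convex_gap:
  fixes C P Q :: "rat set"
  assumes "finite P" "finite Q" "C \<noteq> {}"
    and conv: "\<And>x y c. x \<in> C \<Longrightarrow> y \<in> C \<Longrightarrow> x \<le> c \<Longrightarrow> c \<le> y \<Longrightarrow> c \<in> C"
    and PQ: "\<And>p q. p \<in> P \<Longrightarrow> q \<in> Q \<Longrightarrow> p < q"
    and P: "\<And>p. p \<in> P \<Longrightarrow> \<exists>y\<in>C. p < y" and Q: "\<And>q. q \<in> Q \<Longrightarrow> \<exists>y\<in>C. y < q"
  shows "\<exists>v\<in>C. (\<forall>p\<in>P. p < v) \<and> (\<forall>q\<in>Q. v < q)"
proof -
  have up: "\<exists>y\<in>C. \<forall>p\<in>P. p < y"
  proof (cases "P = {}")
    case False
    then obtain y where y: "y \<in> C" "Max P < y" using P[OF Max_in[OF assms(1)]] by blast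
    then have "\<forall>p\<in>P. p < y" using assms(1) Max_ge le_less_trans by blast
    then show ?thesis using y by blast
  qed (use assms(3) in blast)
  have down: "\<exists>y\<in>C. \<forall>q\<in>Q. y < q"
  proof (cases "Q = {}")
    case False
    then obtain y where y: "y \<in> C" "y < Min Q" using Q[OF Min_in[OF assms(2)]] by blast
    then have "\<forall>q\<in>Q. y < q" using assms(2) Min_le less_le_trans by blast
    then show ?thesis using y by blast
  qed (use assms(3) in blast)
  obtain y where y: "y \<in> C" "\<forall>p\<in>P. p < y" using up by blast
  obtain z where z: "z \<in> C" "\<forall>q\<in>Q. z < q" using down by blast
  show ?thesis
  proof (cases "(\<forall>q\<in>Q. y < q) \<or> (\<forall>p\<in>P. p < z)")
    case True then show ?thesis using y z by blast
  next
    case False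
    then obtain p q where pq: "p \<in> P" "q \<in> Q" "z \<le> p" "q \<le> y" by (auto simp: not_less)
    have M: "Max P \<in> P" "Min Q \<in> Q" using pq assms(1,2) by (auto intro: Max_in Min_in)
    have "p \<le> Max P" "Min Q \<le> q" using pq assms(1,2) by simp_all
    moreover have "Max P < Min Q" using PQ M by blast
    ultimately have v: "z \<le> (Max P + Min Q) / 2" "(Max P + Min Q) / 2 \<le> y"
      "Max P < (Max P + Min Q) / 2" "(Max P + Min Q) / 2 < Min Q"
      using pq by (simp_all add: field_simps)
    have "(Max P + Min Q) / 2 \<in> C" using conv z(1) y(1) v(1,2) by blast
    moreover have "p' < (Max P + Min Q) / 2" if "p' \<in> P" for p'
      using Max_ge[OF assms(1) that] v(3) by simp
    moreover have "(Max P + Min Q) / 2 < q'" if "q' \<in> Q" for q'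
      using Min_le[OF assms(2) that] v(4) by simp
    ultimately show ?thesis by blast
  qed
qed

lemma strict_mono_on_insert:
  fixes t :: "rat \<Rightarrow> rat"
  assumes "strict_mono_on X t" "\<And>x. x \<in> X \<Longrightarrow> x < b \<Longrightarrow> t x < v" "\<And>x. x \<in> X \<Longrightarrow> b < x \<Longrightarrow> v < t x"
  shows "strict_mono_on (insert b X) (t(b := v))"
proof (rule strict_mono_onI)
  fix x y assume xy: "x \<in> insert b X" "y \<in> insert b X" "x < y"
  show "(t(b := v)) x < (t(b := v)) y"
  proof (cases "x = b \<or> y = b")
    case True
    then show ?thesis
    proof
      assume "x = b"
      then have "y \<in> X" "b < y" "y \<noteq> b" using xy by auto
      then show ?thesis using assms(3) \<open>x = b\<close> by simp
    next
      assume "y = b"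
      then have "x \<in> X" "x < b" "x \<noteq> b" using xy by auto
      then show ?thesis using assms(2) \<open>y = b\<close> by simp
    qed
  next
    case False
    then show ?thesis using xy strict_mono_onD[OF assms(1), of x y] by simp
  qed
qed

text \<open>The pair \<open>(u, w)\<close> is an element and its image, in increasing order; \<open>r\<close> is the corresponding
  increasing one of \<open>\<rho>\<close> and its inverse on the orbital \<open>C\<close>.\<close>
lemma extend_by_pair:
  fixes t :: "rat \<Rightarrow> rat"
  assumes fin: "finite X" and t: "strict_mono_on X t" and u: "u < w" and w: "\<And>x. x \<in> X \<Longrightarrow> x < w"
    and "C \<noteq> {}" and conv: "\<And>x y c. x \<in> C \<Longrightarrow> y \<in> C \<Longrightarrow> x \<le> c \<Longrightarrow> c \<le> y \<Longrightarrow> c \<in> C"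
    and C: "\<And>x. x \<in> X \<Longrightarrow> u \<le> x \<Longrightarrow> t x \<in> C" "\<And>x. x \<in> X \<Longrightarrow> t x \<in> C \<or> (\<forall>y\<in>C. t x < y)"
    and r: "\<And>y. y \<in> C \<Longrightarrow> r y \<in> C \<and> y < r y" and down: "\<And>y. y \<in> C \<Longrightarrow> \<exists>z\<in>C. z < y"
    and r_bound: "\<And>x v. (\<And>x. x \<in> X \<Longrightarrow> x < u \<Longrightarrow> t x < v) \<Longrightarrow> v \<in> C \<Longrightarrow> x \<in> X \<Longrightarrow> t x < r v"
  shows "\<exists>t'. strict_mono_on (insert w (insert u X)) t' \<and> (\<forall>x\<in>X. t' x = t x) \<and> t' u \<in> C \<and> t' w = r (t' u)"
proof -
  \<comment> \<open>\<open>v\<close> is to be the value at \<open>u\<close>; if \<open>u\<close>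
    already belongs to \<open>X\<close>, that value is prescribed.\<close>
  have "\<exists>v\<in>C. (u \<in> X \<longrightarrow> v = t u) \<and> (\<forall>x\<in>X. (x < u \<longrightarrow> t x < v) \<and> (u < x \<longrightarrow> v < t x))"
  proof (cases "u \<in> X")
    case True
    have "t u \<in> C" using C(1)[OF True] by simp
    moreover have "\<forall>x\<in>X. (x < u \<longrightarrow> t x < t u) \<and> (u < x \<longrightarrow> t u < t x)"
      using strict_mono_onD[OF t] True by blast
    ultimately show ?thesis by blast
  next
    case False
    have "\<exists>v\<in>C. (\<forall>p\<in>t ` {x \<in> X. x < u}. p < v) \<and> (\<forall>q\<in>t ` {x \<in> X. u < x}. v < q)"
    proof (rule convex_gap[OF _ _ \<open>C \<noteq> {}\<close> conv])
      show "p < q" if "p \<in> t ` {x \<in> X. x < u}" "q \<in> t ` {x \<in> X. u < x}" for p q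
        using that strict_mono_onD[OF t] by fastforce
      show "\<exists>y\<in>C. p < y" if p: "p \<in> t ` {x \<in> X. x < u}" for p
      proof -
        obtain x where x: "x \<in> X" "p = t x" using p by blast
        show ?thesis using C(2)[OF x(1)] r[of p] \<open>C \<noteq> {}\<close> x(2) by blast
      qed
      show "\<exists>y\<in>C. y < q" if q: "q \<in> t ` {x \<in> X. u < x}" for q
        using q C(1) down by fastforce
    qed (use fin in auto)
    then show ?thesis using False by blast
  qed
  then obtain v where v: "v \<in> C" "u \<in> X \<Longrightarrow> v = t u"
    "\<And>x. x \<in> X \<Longrightarrow> x < u \<Longrightarrow> t x < v" "\<And>x. x \<in> X \<Longrightarrow> u < x \<Longrightarrow> v < t x" by blast
  have 1: "strict_mono_on (insert u X) (t(u := v))" by (rule strict_mono_on_insert[OF t v(3,4)])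
  have "t x < r v" if "x \<in> X" for x using r_bound[OF v(3) v(1) that] .
  then have 2: "strict_mono_on (insert w (insert u X)) ((t(u := v))(w := r v))"
    by (intro strict_mono_on_insert[OF 1]) (use u w r[OF v(1)] in \<open>force+\<close>)
  have "\<forall>x\<in>X. ((t(u := v))(w := r v)) x = t x" using v(2) w by auto
  moreover have "((t(u := v))(w := r v)) u = v" using u by simp
  ultimately show ?thesis using 2 v(1) by (intro exI[of _ "(t(u := v))(w := r v)"]) simp
qed

text \<open>\<open>C\<close> is a homomorphism read on points: \<open>zero\<close> is its
  injectivity at color 0 and \<open>link\<close> comes from its constancy on classes. When the
  largest element \<open>b\<close> is added, \<open>link\<close> puts the values at all earlier
  points between \<open>b\<close> and \<open>\<gamma> b\<close> into the orbital \<open>C b\<close>.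
  A value for the smaller of the two can then be found in \<open>C b\<close>, and that of the larger
  follows by \<open>\<rho>\<close> or its inverse.\<close>

lemma partial_conjugation:
  assumes g: "aut \<gamma>" and rho: "aut \<rho>" and "finite A"
    and orb: "\<And>a. a \<in> A \<Longrightarrow> C a \<in> orbitals \<rho>" and col: "\<And>a. a \<in> A \<Longrightarrow> orbcol \<rho> (C a) = par \<gamma> a"
    and mono: "\<And>a b. a \<in> A \<Longrightarrow> b \<in> A \<Longrightarrow> a < b \<Longrightarrow> C a = C b \<or> prec (C a) (C b)"
    and zero: "\<And>a b. a \<in> A \<Longrightarrow> b \<in> A \<Longrightarrow> a < b \<Longrightarrow> \<gamma> a = a \<Longrightarrow> \<gamma> b = b \<Longrightarrow> C a \<noteq> C b"
    and link: "\<And>a b. a \<in> A \<Longrightarrow> b \<in> A \<Longrightarrow> a < b \<Longrightarrow> b \<le> \<gamma> a \<or> \<gamma> b \<le> a \<Longrightarrow> C a = C b"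
  shows "\<exists>t. strict_mono_on (A \<union> \<gamma> ` A) t \<and> (\<forall>a\<in>A. t (\<gamma> a) = \<rho> (t a) \<and> t a \<in> C a)"
  using assms(3-)
proof (induction A rule: finite_linorder_max_induct)
  case empty
  show ?case by (simp add: strict_mono_on_def)
next
  case (insert b B)
  define X where "X = B \<union> \<gamma> ` B"
  have "\<exists>t. strict_mono_on (B \<union> \<gamma> ` B) t \<and> (\<forall>a\<in>B. t (\<gamma> a) = \<rho> (t a) \<and> t a \<in> C a)"
    by (rule insert.IH) (use insert.prems in auto)
  then obtain t where t: "strict_mono_on X t" "\<And>a. a \<in> B \<Longrightarrow> t (\<gamma> a) = \<rho> (t a)" "\<And>a. a \<in> B \<Longrightarrow> t a \<in> C a"
    unfolding X_def by blast
  have lt: "a < b" "\<gamma> a < \<gamma> b" if "a \<in> B" for a using insert.hyps(2) that aut_less[OF g] by simp_all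
  have Cr: "\<rho> y \<in> C a" "inv \<rho> y \<in> C a" "par \<rho> y = par \<gamma> a" if aC: "a \<in> insert b B" "y \<in> C a" for a y
  proof -
    obtain z where z: "C a = orbital \<rho> z" using insert.prems(1)[OF aC(1)] unfolding orbitals_def by blast
    have y: "C a = orbital \<rho> y" using orbital_eq[OF rho, of y z] aC(2) z by simp
    show "\<rho> y \<in> C a" "inv \<rho> y \<in> C a" using y orbital_image[OF rho] orbital_inv_image[OF rho] by simp_all
    show "par \<rho> y = par \<gamma> a" using y insert.prems(2)[OF aC(1)] orbcol_orbital[OF rho] by simp
  qed
  have tX: "\<exists>a\<in>B. t x \<in> C a \<and> (x = a \<or> x = \<gamma> a)" if "x \<in> X" for x
    using that t(2,3) Cr(1) unfolding X_def by fastforce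
  have Cb: "C b \<noteq> {}" "\<And>x y c. x \<in> C b \<Longrightarrow> y \<in> C b \<Longrightarrow> x \<le> c \<Longrightarrow> c \<le> y \<Longrightarrow> c \<in> C b"
  proof -
    obtain z where z: "C b = orbital \<rho> z" using insert.prems(1)[of b] unfolding orbitals_def by blast
    show "C b \<noteq> {}" using z orbital_self[of z \<rho>] by auto
    show "\<And>x y c. x \<in> C b \<Longrightarrow> y \<in> C b \<Longrightarrow> x \<le> c \<Longrightarrow> c \<le> y \<Longrightarrow> c \<in> C b"
      unfolding z by (rule orbital_convex)
  qed
  have low: "t x \<in> C b \<or> (\<forall>y\<in>C b. t x < y)" if xX: "x \<in> X" for x
  proof -
    obtain a where a: "a \<in> B" "t x \<in> C a" using tX[OF xX] by blast
    then have "C a = C b \<or> prec (C a) (C b)" using insert.prems(3)[of a b] lt by simp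
    then show ?thesis using a unfolding setlt_def by blast
  qed
  have Xins: "insert b B \<union> \<gamma> ` insert b B = insert (\<gamma> b) (insert b X)" unfolding X_def by blast
  have finX: "finite X" using insert.hyps unfolding X_def by simp
  have finish: ?case if t': "strict_mono_on (insert (\<gamma> b) (insert b X)) t'" "\<forall>x\<in>X. t' x = t x"
      "t' (\<gamma> b) = \<rho> (t' b)" "t' b \<in> C b" for t'
  proof (intro exI[of _ t'] conjI ballI)
    show "strict_mono_on (insert b B \<union> \<gamma> ` insert b B) t'" using t'(1) unfolding Xins .
    fix a assume "a \<in> insert b B"
    then show "t' (\<gamma> a) = \<rho> (t' a)" "t' a \<in> C a" using t'(2,3,4) t(2,3) unfolding X_def by auto
  qed
  consider "b < \<gamma> b" | "\<gamma> b = b" | "\<gamma> b < b" by fastforce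
  then show ?case
  proof cases
    case 1
    then have up: "y < \<rho> y" if "y \<in> C b" for y using Cr(3)[OF insertI1 that] 1 par_Pos[of \<rho> y] par_Pos[of \<gamma> b] by simp
    have "\<exists>t'. strict_mono_on (insert (\<gamma> b) (insert b X)) t' \<and> (\<forall>x\<in>X. t' x = t x) \<and> t' b \<in> C b \<and> t' (\<gamma> b) = \<rho> (t' b)"
    proof (rule extend_by_pair[OF finX t(1) 1 _ Cb _ low])
      show "x < \<gamma> b" if x: "x \<in> X" for x
      proof -
        obtain a where "a \<in> B" "x = a \<or> x = \<gamma> a" using x unfolding X_def by blast
        then show ?thesis using lt[of a] 1 by auto
      qed
      show "t x \<in> C b" if x: "x \<in> X" "b \<le> x" for x
      proof -
        obtain a where a: "a \<in> B" "t x \<in> C a" "x = a \<or> x = \<gamma> a" using tX[OF x(1)] by blast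
        then have "b \<le> \<gamma> a" using lt(1)[OF a(1)] x(2) by auto
        then show ?thesis using insert.prems(5)[of a b] a lt by simp
      qed
      show "\<rho> y \<in> C b \<and> y < \<rho> y" if "y \<in> C b" for y using up that Cr by simp
      show "\<exists>z\<in>C b. z < y" if "y \<in> C b" for y
        using up[of "inv \<rho> y"] Cr(2)[of b y] that aut_inv_right[OF rho] by auto
      \<comment> \<open>\<open>x\<close> itself may lie beyond \<open>b\<close>, but then it is the
        image of some \<open>a < b\<close>, and \<open>\<rho>\<close> carries \<open>t a < v\<close>
        over to it.\<close>
      show "t x < \<rho> v" if v: "\<And>x. x \<in> X \<Longrightarrow> x < b \<Longrightarrow> t x < v" "v \<in> C b" and x: "x \<in> X" for x v
      proof -
        obtain a where a: "a \<in> B" "x = a \<or> x = \<gamma> a" using tX[OF x] by blast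
        have "t a < v" using v(1)[of a] a(1) lt unfolding X_def by simp
        then show ?thesis
          using a t(2)[OF a(1)] up[OF v(2)] aut_less[OF rho, of "t a" v] by auto
      qed
    qed
    then show ?thesis using finish by blast
  next
    case 2
    have ab: "\<gamma> a < b" if "a \<in> B" for a using lt(2)[OF that] 2 by simp
    obtain v where v: "v \<in> C b" using Cb(1) by blast
    have fixed: "\<rho> v = v" using Cr(3)[OF insertI1 v] 2 par_Zero[of \<rho> v] par_Zero[of \<gamma> b] by simp
    have "t x < v" if x: "x \<in> X" for x
    proof -
      obtain a where a: "a \<in> B" "t x \<in> C a" using tX[OF x] by blast
      \<comment> \<open>An earlier element sharing this orbital would have color 0 as well, hence be
        a fixed point, which \<open>zero\<close> excludes.\<close>
      have "C a \<noteq> C b"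
      proof
        assume eq: "C a = C b"
        then have "par \<gamma> a = par \<gamma> b" using insert.prems(2)[of a] insert.prems(2)[of b] a(1) by simp
        then have "\<gamma> a = a" using 2 par_Zero by metis
        then show False using insert.prems(4)[of a b] a(1) lt 2 eq by simp
      qed
      then have "prec (C a) (C b)" using insert.prems(3)[of a b] a(1) lt by simp
      then show ?thesis using a v unfolding setlt_def by blast
    qed
    moreover have "x < b" if "x \<in> X" for x using that lt ab unfolding X_def by blast
    ultimately have sm: "strict_mono_on (insert b X) (t(b := v))" "b \<notin> X"
      by (auto intro!: strict_mono_on_insert[OF t(1)] dest: less_asym)
    show ?thesis by (rule finish[of "t(b := v)"]) (use sm 2 v fixed in auto)
  next
    case 3
    then have dn: "\<rho> y < y" if "y \<in> C b" for y using Cr(3)[OF insertI1 that] 3 par_Neg[of \<rho> y] par_Neg[of \<gamma> b] by simp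
    have up: "y < inv \<rho> y" if "y \<in> C b" for y
      using dn[of "inv \<rho> y"] Cr(2)[of b y] that aut_inv_right[OF rho] by simp
    have "\<exists>t'. strict_mono_on (insert b (insert (\<gamma> b) X)) t' \<and> (\<forall>x\<in>X. t' x = t x) \<and> t' (\<gamma> b) \<in> C b \<and> t' b = inv \<rho> (t' (\<gamma> b))"
    proof (rule extend_by_pair[OF finX t(1) 3 _ Cb _ low])
      show "x < b" if x: "x \<in> X" for x
      proof -
        obtain a where "a \<in> B" "x = a \<or> x = \<gamma> a" using x unfolding X_def by blast
        then show ?thesis using lt[of a] 3 by auto
      qed
      show "t x \<in> C b" if x: "x \<in> X" "\<gamma> b \<le> x" for x
      proof -
        obtain a where a: "a \<in> B" "t x \<in> C a" "x = a \<or> x = \<gamma> a" using tX[OF x(1)] by blast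
        then have "\<gamma> b \<le> a" using lt(2)[OF a(1)] x(2) by auto
        then show ?thesis using insert.prems(5)[of a b] a lt by simp
      qed
      show "inv \<rho> y \<in> C b \<and> y < inv \<rho> y" if "y \<in> C b" for y using up that Cr by simp
      show "\<exists>z\<in>C b. z < y" if "y \<in> C b" for y using dn[of y] Cr(1)[of b y] that by auto
      \<comment> \<open>Now it is \<open>a\<close> that may lie beyond \<open>\<gamma> b\<close>;
        its image stays below \<open>\<gamma> b\<close>, and the bound on
        \<open>t (\<gamma> a)\<close> is pulled back by \<open>inv \<rho>\<close>.\<close>
      show "t x < inv \<rho> v" if v: "\<And>x. x \<in> X \<Longrightarrow> x < \<gamma> b \<Longrightarrow> t x < v" "v \<in> C b" and x: "x \<in> X" for x v
      proof -
        obtain a where a: "a \<in> B" "x = a \<or> x = \<gamma> a" using tX[OF x] by blast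
        have "t (\<gamma> a) < v" using v(1)[of "\<gamma> a"] a(1) lt unfolding X_def by simp
        moreover from this have "t a < inv \<rho> v"
          using t(2)[OF a(1)] aut_less[OF rho, of "t a" "inv \<rho> v"] aut_inv_right[OF rho] by simp
        ultimately show ?thesis using a(2) up[OF v(2)] by auto
      qed
    qed
    then obtain t' where t': "strict_mono_on (insert (\<gamma> b) (insert b X)) t'" "\<forall>x\<in>X. t' x = t x"
      "t' (\<gamma> b) \<in> C b" "t' b = inv \<rho> (t' (\<gamma> b))" by (auto simp: insert_commute)
    show ?thesis by (rule finish[OF t'(1,2)]) (use t'(3,4) aut_inv_right[OF rho] Cr(2)[of b] in simp_all)
  qed
qed

section \<open>The relation generated by a partial isomorphism\<close>

lemma restr_eq_Some: "restr g A a = Some c \<longleftrightarrow> a \<in> A \<and> c = g a"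
  unfolding restr_def restrict_map_def by auto

lemma pinv_restr_eq_Some:
  assumes "aut g"
  shows "pinv (restr g A) a = Some c \<longleftrightarrow> c \<in> A \<and> g c = a"
proof -
  have ran: "a \<in> ran (restr g A) \<longleftrightarrow> (\<exists>x\<in>A. g x = a)"
    unfolding ran_def restr_eq_Some by auto
  have inj: "x = y" if "g x = g y" for x y using that aut_inv_left[OF assms] by metis
  have "(THE x. restr g A x = Some a) = x" if "x \<in> A" "g x = a" for x
    by (rule the_equality) (use that inj in \<open>auto simp: restr_eq_Some\<close>)
  then show ?thesis unfolding pinv_def ran using inj by auto
qed

lemma ppar_restr:
  assumes "a \<in> A"
  shows "ppar (restr g A) a = Some (par g a)"
  using assms unfolding ppar_def par_def restr_def restrict_map_def by simp

lemma ppar_restr_image: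
  assumes g: "aut g" and "c \<in> A" "g c = a"
  shows "ppar (restr g A) a = Some (par g c)"
proof (cases "a \<in> A")
  case True
  then show ?thesis using ppar_restr orbital_par[OF g orbital_image[OF g]] assms(3) by metis
next
  case False
  then have "restr g A a = None" unfolding restr_def restrict_map_def by simp
  moreover have "pinv (restr g A) a = Some c" using pinv_restr_eq_Some[OF g] assms by simp
  ultimately show ?thesis using assms unfolding ppar_def par_def by simp
qed

lemma prel_commute: "prel p a b \<longleftrightarrow> prel p b a"
  unfolding prel_def by blast

lemma psim_eq: "psim p = (prel p)\<^sup>*\<^sup>*"
proof -
  have "(\<lambda>a b. prel p a b \<or> prel p b a) = prel p" by (intro ext) (metis prel_commute)
  then show ?thesis unfolding psim_def by simp
qed

lemma psim_refl: "psim p a a"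
  unfolding psim_eq by simp

lemma psim_trans: "psim p a b \<Longrightarrow> psim p b c \<Longrightarrow> psim p a c"
  unfolding psim_eq by simp

lemma psim_sym: "psim p a b \<Longrightarrow> psim p b a"
  unfolding psim_eq using symp_rtranclp[of "prel p"] prel_commute by (metis sympD sympI)

lemma prel_psim: "prel p a b \<Longrightarrow> psim p a b"
  unfolding psim_eq by simp

text \<open>The clauses of \<open>prel\<close> stripped of their parity guards: \<open>y\<close>
  lies between \<open>x\<close> and its image or preimage. For restrictions of an automorphism the
  guards hold by themselves unless \<open>x\<close> is fixed, and then \<open>y = x\<close>.\<close>

definition linked :: "(rat \<rightharpoonup> rat) \<Rightarrow> rat \<Rightarrow> rat \<Rightarrow> bool" where
  "linked p x y \<longleftrightarrow> (\<exists>d. (p x = Some d \<or> pinv p x = Some d) \<and> (x \<le> y \<and> y \<le> d \<or> d \<le> y \<and> y \<le> x))"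

lemma linked_prel:
  assumes g: "aut g" and "linked (restr g A) x y"
  shows "prel (restr g A) x y"
proof -
  let ?p = "restr g A"
  obtain d where d: "?p x = Some d \<or> pinv ?p x = Some d" "x \<le> y \<and> y \<le> d \<or> d \<le> y \<and> y \<le> x"
    using assms(2) unfolding linked_def by blast
  show ?thesis
  proof (cases "x = d")
    case True
    then show ?thesis using d(2) unfolding prel_def by auto
  next
    case False
    from d(1) show ?thesis
    proof
      assume px: "?p x = Some d"
      then have *: "ppar ?p x = Some (par g x)" "d = g x" using ppar_restr by (simp_all add: restr_eq_Some)
      from d(2) show ?thesis
      proof
        assume xy: "x \<le> y \<and> y \<le> d"
        then have "ppar ?p x = Some Pos" using * False par_Pos[of g x] by simp
        then show ?thesis using px xy unfolding prel_def by blast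
      next
        assume xy: "d \<le> y \<and> y \<le> x"
        then have "ppar ?p x = Some Neg" using * False par_Neg[of g x] by simp
        then show ?thesis using px xy unfolding prel_def by blast
      qed
    next
      assume px: "pinv ?p x = Some d"
      then have *: "ppar ?p x = Some (par g d)" "x = g d"
        using ppar_restr_image[OF g] pinv_restr_eq_Some[OF g] by auto
      from d(2) show ?thesis
      proof
        assume xy: "x \<le> y \<and> y \<le> d"
        then have "ppar ?p x = Some Neg" using * False par_Neg[of g d] by simp
        then show ?thesis using px xy unfolding prel_def by blast
      next
        assume xy: "d \<le> y \<and> y \<le> x"
        then have "ppar ?p x = Some Pos" using * False par_Pos[of g d] by simp
        then show ?thesis using px xy unfolding prel_def by blast
      qed
    qed
  qed
qed

lemma prel_linked:
  assumes "prel p a b"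
  shows "a = b \<or> linked p a b \<or> linked p b a"
  using assms unfolding prel_def linked_def by (elim disjE conjE exE; blast)

lemma linked_orbital:
  assumes g: "aut g" and "linked (restr g A) x y"
  shows "orbital g y = orbital g x"
proof -
  obtain d where d: "restr g A x = Some d \<or> pinv (restr g A) x = Some d" "x \<le> y \<and> y \<le> d \<or> d \<le> y \<and> y \<le> x"
    using assms(2) unfolding linked_def by blast
  have "d \<in> orbital g x"
    using d(1)
  proof
    assume "restr g A x = Some d"
    then show ?thesis using orbital_image[OF g] by (simp add: restr_eq_Some)
  next
    assume "pinv (restr g A) x = Some d"
    then have "g d = x" using pinv_restr_eq_Some[OF g] by simp
    then show ?thesis using orbital_sym[OF g, of x d] orbital_image[OF g, of d] by simp
  qed
  then have "y \<in> orbital g x" using d(2) orbital_convex orbital_self by metis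
  then show ?thesis by (rule orbital_eq[OF g])
qed

lemma prel_orbital:
  assumes g: "aut g" and "prel (restr g A) a b"
  shows "orbital g b = orbital g a"
  using prel_linked[OF assms(2)] linked_orbital[OF g] by metis

text \<open>Makes the color of a class well defined and keeps distinct fixed points in distinct
  classes.\<close>

lemma psim_orbital:
  assumes g: "aut g" and "psim (restr g A) a b"
  shows "orbital g b = orbital g a"
  using assms(2) unfolding psim_eq
proof (induction rule: rtranclp_induct)
  case (step y z) then show ?case using prel_orbital[OF g step(2)] by simp
qed simp

lemma prel_between:
  assumes g: "aut g" and ab: "prel (restr g A) a b" and c: "(a \<le> c \<and> c \<le> b) \<or> (b \<le> c \<and> c \<le> a)"
  shows "prel (restr g A) a c \<or> prel (restr g A) b c"
proof -
  have between: "linked p x c" if "linked p x y" "(x \<le> c \<and> c \<le> y) \<or> (y \<le> c \<and> c \<le> x)" for p x y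
    using that unfolding linked_def by (meson order_trans)
  from prel_linked[OF ab] show ?thesis
  proof (elim disjE)
    assume "a = b"
    then have "a = c" using c by auto
    then show ?thesis unfolding prel_def by simp
  next
    assume "linked (restr g A) a b"
    then show ?thesis using between c linked_prel[OF g] by blast
  next
    assume "linked (restr g A) b a"
    then show ?thesis using between c linked_prel[OF g] by blast
  qed
qed

text \<open>A path of related points from \<open>a\<close> to \<open>b\<close> has a step that
  reaches or crosses \<open>c\<close>, and \<open>prel_between\<close> relates \<open>c\<close> to
  an end of that step. Convexity of the classes is what orders them by \<open>prec\<close>.\<close>

lemma psim_between:
  assumes g: "aut g" and "psim (restr g A) a b" and "(a \<le> c \<and> c \<le> b) \<or> (b \<le> c \<and> c \<le> a)"
  shows "psim (restr g A) a c"
  using assms(2) unfolding psim_eq using assms(3)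
proof (induction rule: rtranclp_induct)
  case base
  then show ?case by auto
next
  case (step y z)
  show ?case
  proof (cases "(a \<le> c \<and> c \<le> y) \<or> (y \<le> c \<and> c \<le> a)")
    case True then show ?thesis using step.IH by blast
  next
    case False
    then have "(y \<le> c \<and> c \<le> z) \<or> (z \<le> c \<and> c \<le> y)" using step.prems by auto
    then have "prel (restr g A) y c \<or> prel (restr g A) z c" by (rule prel_between[OF g step(2)])
    then show ?thesis using step(1,2) by (meson rtranclp.rtrancl_into_rtrancl)
  qed
qed

lemma psim_class_prec:
  assumes g: "aut g" and "a < b" "\<not> psim (restr g A) a b"
  shows "prec {x. psim (restr g A) a x} {x. psim (restr g A) b x}"
  unfolding setlt_def
proof (intro ballI)
  fix x y assume "x \<in> {x. psim (restr g A) a x}" "y \<in> {x. psim (restr g A) b x}"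
  then have xy: "psim (restr g A) a x" "psim (restr g A) b y" by simp_all
  show "x < y"
  proof (rule ccontr)
    assume "\<not> x < y"
    show False
    proof (cases "b \<le> x")
      case True
      then show False using psim_between[OF g xy(1), of b] assms by simp
    next
      case False
      then have "psim (restr g A) b x" using psim_between[OF g xy(2), of x] \<open>\<not> x < y\<close> by simp
      then show False using xy(1) assms(3) psim_sym psim_trans by blast
    qed
  qed
qed

lemma psim_class_eq_iff: "{x. psim p a x} = {x. psim p b x} \<longleftrightarrow> psim p a b"
  using psim_refl psim_sym psim_trans by blast

lemma pclcol_class:
  assumes g: "aut g" and "a \<in> A"
  shows "pclcol (restr g A) A {x. psim (restr g A) a x} = par g a"
proof -
  define s where "s = (SOME x. x \<in> A \<and> x \<in> {x. psim (restr g A) a x})"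
  have "s \<in> A \<and> s \<in> {x. psim (restr g A) a x}"
    unfolding s_def by (rule someI[of _ a]) (use assms(2) psim_refl in auto)
  then have s: "s \<in> A" "psim (restr g A) a s" by simp_all
  have "s \<in> orbital g a" using psim_orbital[OF g s(2)] orbital_self by metis
  then have "par g s = par g a" by (rule orbital_par[OF g])
  then show ?thesis unfolding pclcol_def s_def[symmetric] using ppar_restr[OF s(1)] by simp
qed

section \<open>The closure of the conjugacy class tested on finite sets\<close>

lemma topspace_ptw_top: "topspace ptw_top = {f. aut f}"
  unfolding ptw_top_def by simp

text \<open>Each factor of the product is discrete, so a basic neighborhood of \<gamma> can be
  shrunk to one that prescribes the values on a finite set.\<close>

lemma conj_closure_iff:
  assumes rho: "aut \<rho>" and g: "aut \<gamma>"
  shows "\<gamma> \<in> conj_closure \<rho> \<longleftrightarrow>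
    (\<forall>A. finite A \<longrightarrow> (\<exists>\<sigma>. aut \<sigma> \<and> (\<forall>a\<in>A. (\<sigma> \<circ> \<rho> \<circ> inv \<sigma>) a = \<gamma> a)))"
proof
  assume cl: "\<gamma> \<in> conj_closure \<rho>"
  show "\<forall>A. finite A \<longrightarrow> (\<exists>\<sigma>. aut \<sigma> \<and> (\<forall>a\<in>A. (\<sigma> \<circ> \<rho> \<circ> inv \<sigma>) a = \<gamma> a))"
  proof (intro allI impI)
    fix A :: "rat set" assume A: "finite A"
    define U where "U = (\<Pi>\<^sub>E i\<in>UNIV. if i \<in> A then {\<gamma> i} else UNIV)"
    have "openin (product_topology (\<lambda>_. discrete_topology (UNIV :: rat set)) UNIV) U"
      unfolding U_def
    proof (rule product_topology_basis)
      have "{i. (if i \<in> A then {\<gamma> i} else UNIV) \<noteq> topspace (discrete_topology UNIV)} \<subseteq> A" by auto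
      then show "finite {i. (if i \<in> A then {\<gamma> i} else UNIV) \<noteq> topspace (discrete_topology UNIV)}"
        using A finite_subset by blast
    qed simp
    then have "openin ptw_top (U \<inter> {f. aut f})" unfolding ptw_top_def openin_subtopology by blast
    moreover have "\<gamma> \<in> U \<inter> {f. aut f}" using g unfolding U_def by auto
    moreover have "\<forall>T. \<gamma> \<in> T \<and> openin ptw_top T \<longrightarrow> (\<exists>f. f \<in> {\<sigma> \<circ> \<rho> \<circ> inv \<sigma> | \<sigma>. aut \<sigma>} \<and> f \<in> T)"
      using cl unfolding conj_closure_def in_closure_of by (rule conjunct2)
    ultimately obtain f where f: "f \<in> {\<sigma> \<circ> \<rho> \<circ> inv \<sigma> | \<sigma>. aut \<sigma>}" "f \<in> U"
      by (meson IntD1)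
    then obtain \<sigma> where \<sigma>: "aut \<sigma>" "f = \<sigma> \<circ> \<rho> \<circ> inv \<sigma>" by blast
    have "f a = \<gamma> a" if "a \<in> A" for a
      using PiE_mem[OF f(2)[unfolded U_def], of a] that by simp
    then show "\<exists>\<sigma>. aut \<sigma> \<and> (\<forall>a\<in>A. (\<sigma> \<circ> \<rho> \<circ> inv \<sigma>) a = \<gamma> a)" using \<sigma> by blast
  qed
next
  assume fin: "\<forall>A. finite A \<longrightarrow> (\<exists>\<sigma>. aut \<sigma> \<and> (\<forall>a\<in>A. (\<sigma> \<circ> \<rho> \<circ> inv \<sigma>) a = \<gamma> a))"
  show "\<gamma> \<in> conj_closure \<rho>"
    unfolding conj_closure_def in_closure_of topspace_ptw_top
  proof (intro conjI allI impI)
    show "\<gamma> \<in> {f. aut f}" using g by simp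
    fix V assume V: "\<gamma> \<in> V \<and> openin ptw_top V"
    then obtain T where T: "openin (product_topology (\<lambda>_. discrete_topology (UNIV :: rat set)) UNIV) T"
      "V = T \<inter> {f. aut f}" unfolding ptw_top_def openin_subtopology by blast
    then obtain U where U: "finite {i \<in> UNIV. U i \<noteq> topspace (discrete_topology (UNIV :: rat set))}"
      "\<gamma> \<in> Pi\<^sub>E UNIV U" "Pi\<^sub>E UNIV U \<subseteq> T"
      using V unfolding openin_product_topology_alt by blast
    have "finite {i. U i \<noteq> UNIV}" using U(1) by simp
    from fin[rule_format, OF this] obtain \<sigma> where \<sigma>: "aut \<sigma>" "\<And>a. U a \<noteq> UNIV \<Longrightarrow> (\<sigma> \<circ> \<rho> \<circ> inv \<sigma>) a = \<gamma> a"
      by blast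
    have "(\<sigma> \<circ> \<rho> \<circ> inv \<sigma>) i \<in> U i" for i
      using \<sigma>(2)[of i] PiE_mem[OF U(2), of i] by (cases "U i = UNIV") auto
    then have "\<sigma> \<circ> \<rho> \<circ> inv \<sigma> \<in> Pi\<^sub>E UNIV U" by auto
    moreover have "aut (\<sigma> \<circ> \<rho> \<circ> inv \<sigma>)" by (intro aut_comp \<sigma>(1) rho aut_inv)
    ultimately show "\<exists>f. f \<in> {\<sigma> \<circ> \<rho> \<circ> inv \<sigma> | \<sigma>. aut \<sigma>} \<and> f \<in> V" using U(3) T(2) \<sigma>(1) by blast
  qed
qed

section \<open>The equivalences\<close>

text \<open>One point per orbital is enough: where \<gamma> agrees with the conjugate,
  \<open>t = inv \<sigma>\<close> preserves the direction of movement, and orbitals are ordered like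
  their representatives. Agreement at finitely many points may merge orbitals of color + or -, but
  fixed points go to distinct fixed points.\<close>

lemma fin_hom_of_conj_closure:
  assumes rho: "aut \<rho>" and g: "aut \<gamma>" and cl: "\<gamma> \<in> conj_closure \<rho>"
  shows "fin_hom (orbitals \<gamma>) prec (orbcol \<gamma>) (orbitals \<rho>) prec (orbcol \<rho>)"
  unfolding fin_hom_def
proof (intro allI impI, elim conjE)
  fix F assume F: "finite F" "F \<subseteq> orbitals \<gamma>"
  have "\<exists>x. I = orbital \<gamma> x" if "I \<in> F" for I using that F(2) unfolding orbitals_def by blast
  then obtain x where x: "\<And>I. I \<in> F \<Longrightarrow> I = orbital \<gamma> (x I)" by metis
  have "finite (x ` F)" using F(1) by simp
  from cl[unfolded conj_closure_iff[OF rho g], rule_format, OF this]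
  obtain \<sigma> where \<sigma>: "aut \<sigma>" "\<forall>a\<in>x ` F. (\<sigma> \<circ> \<rho> \<circ> inv \<sigma>) a = \<gamma> a" by blast
  define t where "t = inv \<sigma>"
  have t: "aut t" unfolding t_def by (rule aut_inv[OF \<sigma>(1)])
  have comm: "t (\<gamma> (x I)) = \<rho> (t (x I))" if "I \<in> F" for I
    using \<sigma>(2) that aut_inv_left[OF \<sigma>(1), of "\<rho> (inv \<sigma> (x I))"] unfolding t_def by simp
  define phi where "phi I = orbital \<rho> (t (x I))" for I
  have par: "par \<rho> (t (x I)) = par \<gamma> (x I)" if "I \<in> F" for I
  proof -
    have "t (x I) < \<rho> (t (x I)) \<longleftrightarrow> x I < \<gamma> (x I)" "\<rho> (t (x I)) < t (x I) \<longleftrightarrow> \<gamma> (x I) < x I"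
      unfolding comm[OF that, symmetric] by (rule aut_less[OF t])+
    then show ?thesis unfolding par_def sgnc_def by simp (metis linorder_neq_iff order_less_irrefl)
  qed
  have colI: "orbcol \<gamma> I = par \<gamma> (x I)" if "I \<in> F" for I
    using orbcol_orbital[OF g, of "x I"] x[OF that] by simp
  have "orbcol \<rho> (phi I) = orbcol \<gamma> I" if "I \<in> F" for I
    using orbcol_orbital[OF rho] par[OF that] colI[OF that] unfolding phi_def by simp
  moreover have "lew prec (phi I) (phi J)" if IJ: "I \<in> F" "J \<in> F" "lew prec I J" for I J
  proof (cases "I = J")
    case False
    then have "prec I J" using IJ(3) unfolding lew_def by simp
    moreover have "x I \<in> I" "x J \<in> J" using x IJ orbital_self by blast+
    ultimately have "x I < x J" unfolding setlt_def by blast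
    then have "t (x I) < t (x J)" using aut_less[OF t] by simp
    then show ?thesis using orbital_prec[OF rho] unfolding phi_def lew_def by blast
  qed (simp add: lew_def)
  moreover have "inj_on phi {I \<in> F. orbcol \<gamma> I = Zero}"
  proof (rule inj_onI)
    fix I J assume "I \<in> {I \<in> F. orbcol \<gamma> I = Zero}" "J \<in> {I \<in> F. orbcol \<gamma> I = Zero}" and eq: "phi I = phi J"
    then have IJ: "I \<in> F" "J \<in> F" "par \<gamma> (x I) = Zero" "par \<gamma> (x J) = Zero" using colI by auto
    then have "\<rho> (t (x I)) = t (x I)" "\<rho> (t (x J)) = t (x J)" using par by (simp_all add: par_Zero[symmetric])
    then have "t (x I) = t (x J)" using eq orbital_fixed[OF rho] unfolding phi_def by simp
    then have "x I = x J" using aut_inv_left[OF t] by metis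
    then show "I = J" using x IJ by metis
  qed
  ultimately have "wp_hom F prec (orbcol \<gamma>) (orbitals \<rho>) prec (orbcol \<rho>) phi"
    unfolding wp_hom_def by (simp add: phi_def orbitals_def)
  then show "\<exists>phi. wp_hom F prec (orbcol \<gamma>) (orbitals \<rho>) prec (orbcol \<rho>) phi" by blast
qed

text \<open>The given map is composed with the one from classes to orbitals of \<gamma>. Several
  classes may lie in one orbital, but a class of color 0 is determined by the fixed point that forms
  its orbital.\<close>

lemma pclasses_wp_hom_of_fin_hom:
  assumes rho: "aut \<rho>" and g: "aut \<gamma>" and A: "finite A"
    and h: "fin_hom (orbitals \<gamma>) prec (orbcol \<gamma>) (orbitals \<rho>) prec (orbcol \<rho>)"
  shows "\<exists>phi. wp_hom (pclasses (restr \<gamma> A) A) prec (pclcol (restr \<gamma> A) A) (orbitals \<rho>) prec (orbcol \<rho>) phi"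
proof -
  define cls where "cls a = {x. psim (restr \<gamma> A) a x}" for a
  have cls_eq: "cls a = cls b \<longleftrightarrow> psim (restr \<gamma> A) a b" for a b
    unfolding cls_def by (rule psim_class_eq_iff)
  have classes: "pclasses (restr \<gamma> A) A = cls ` A" unfolding pclasses_def cls_def by blast
  have sub: "orbital \<gamma> ` A \<subseteq> orbitals \<gamma>" unfolding orbitals_def by blast
  obtain psi where psi: "\<forall>I\<in>orbital \<gamma> ` A. psi I \<in> orbitals \<rho> \<and> orbcol \<rho> (psi I) = orbcol \<gamma> I"
    "\<forall>I\<in>orbital \<gamma> ` A. \<forall>J\<in>orbital \<gamma> ` A. lew prec I J \<longrightarrow> lew prec (psi I) (psi J)"
    "\<forall>I\<in>orbital \<gamma> ` A. \<forall>J\<in>orbital \<gamma> ` A. orbcol \<gamma> I = Zero \<longrightarrow> psi I = psi J \<longrightarrow> I = J"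
    by (rule fin_homD[OF h finite_imageI[OF A] sub])
  have "\<exists>a. a \<in> A \<and> c = cls a" if "c \<in> cls ` A" for c using that by blast
  then obtain r where r: "\<And>c. c \<in> cls ` A \<Longrightarrow> r c \<in> A" "\<And>c. c \<in> cls ` A \<Longrightarrow> c = cls (r c)" by metis
  define phi where "phi c = psi (orbital \<gamma> (r c))" for c
  have col: "pclcol (restr \<gamma> A) A c = par \<gamma> (r c)" if "c \<in> cls ` A" for c
    using pclcol_class[OF g r(1)[OF that]] r(2)[OF that] unfolding cls_def by simp
  have "phi c \<in> orbitals \<rho>" "orbcol \<rho> (phi c) = pclcol (restr \<gamma> A) A c" if "c \<in> cls ` A" for c
    using psi(1) r(1)[OF that] orbcol_orbital[OF g] col[OF that] unfolding phi_def by simp_all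
  moreover have "lew prec (phi c) (phi d)" if cd: "c \<in> cls ` A" "d \<in> cls ` A" "lew prec c d" for c d
  proof (cases "c = d")
    case False
    then have "prec c d" using cd(3) unfolding lew_def by simp
    moreover have "r c \<in> c" "r d \<in> d"
      using r(2)[OF cd(1)] r(2)[OF cd(2)] psim_refl unfolding cls_def by blast+
    ultimately have "r c < r d" unfolding setlt_def by blast
    then have "lew prec (orbital \<gamma> (r c)) (orbital \<gamma> (r d))"
      using orbital_prec[OF g] unfolding lew_def by blast
    then show ?thesis using psi(2) r(1)[OF cd(1)] r(1)[OF cd(2)] unfolding phi_def by simp
  qed (simp add: lew_def)
  moreover have "inj_on phi {c \<in> cls ` A. pclcol (restr \<gamma> A) A c = Zero}"
  proof (rule inj_onI)
    fix c d
    assume "c \<in> {c \<in> cls ` A. pclcol (restr \<gamma> A) A c = Zero}"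
      "d \<in> {c \<in> cls ` A. pclcol (restr \<gamma> A) A c = Zero}" and eq: "phi c = phi d"
    then have cd: "c \<in> cls ` A" "d \<in> cls ` A" "par \<gamma> (r c) = Zero" "par \<gamma> (r d) = Zero" using col by auto
    have "orbital \<gamma> (r c) = orbital \<gamma> (r d)"
      using psi(3) eq r(1)[OF cd(1)] r(1)[OF cd(2)] orbcol_orbital[OF g] cd(3) unfolding phi_def by simp
    then have "r c = r d" using cd(3,4) orbital_fixed[OF g] by (simp add: par_Zero)
    then show "c = d" using r(2)[OF cd(1)] r(2)[OF cd(2)] by simp
  qed
  ultimately have "wp_hom (cls ` A) prec (pclcol (restr \<gamma> A) A) (orbitals \<rho>) prec (orbcol \<rho>) phi"
    unfolding wp_hom_def by simp
  then show ?thesis unfolding classes by blast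
qed

lemma conj_closure_of_pclasses_wp_hom:
  assumes rho: "aut \<rho>" and g: "aut \<gamma>"
    and h: "\<And>A. finite A \<Longrightarrow> \<exists>phi. wp_hom (pclasses (restr \<gamma> A) A) prec (pclcol (restr \<gamma> A) A) (orbitals \<rho>) prec (orbcol \<rho>) phi"
  shows "\<gamma> \<in> conj_closure \<rho>"
  unfolding conj_closure_iff[OF rho g]
proof (intro allI impI)
  fix A :: "rat set" assume A: "finite A"
  let ?p = "restr \<gamma> A"
  obtain phi where phi: "wp_hom (pclasses ?p A) prec (pclcol ?p A) (orbitals \<rho>) prec (orbcol \<rho>) phi"
    using h[OF A] by blast
  define cls where "cls a = {x. psim ?p a x}" for a
  have cls_eq: "cls a = cls b \<longleftrightarrow> psim ?p a b" for a b
    unfolding cls_def by (rule psim_class_eq_iff)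
  have mem: "cls a \<in> pclasses ?p A" if "a \<in> A" for a using that unfolding pclasses_def cls_def by blast
  have col: "pclcol ?p A (cls a) = par \<gamma> a" if "a \<in> A" for a
    unfolding cls_def by (rule pclcol_class[OF g that])
  define C where "C a = phi (cls a)" for a
  have "\<exists>t. strict_mono_on (A \<union> \<gamma> ` A) t \<and> (\<forall>a\<in>A. t (\<gamma> a) = \<rho> (t a) \<and> t a \<in> C a)"
  proof (rule partial_conjugation[OF g rho A])
    fix a assume "a \<in> A"
    then show "C a \<in> orbitals \<rho>" "orbcol \<rho> (C a) = par \<gamma> a"
      using phi mem col unfolding wp_hom_def C_def by simp_all
  next
    fix a b assume ab: "a \<in> A" "b \<in> A" "a < b"
    have "lew prec (cls a) (cls b)"
      using psim_class_prec[OF g ab(3), of A] cls_eq[of a b] unfolding lew_def cls_def by blast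
    then have "lew prec (C a) (C b)" using phi mem ab unfolding wp_hom_def C_def by simp
    then show "C a = C b \<or> prec (C a) (C b)" unfolding lew_def by blast
    show "C a \<noteq> C b" if fixed: "\<gamma> a = a" "\<gamma> b = b"
    proof
      assume "C a = C b"
      moreover have "inj_on phi {c \<in> pclasses ?p A. pclcol ?p A c = Zero}" using phi unfolding wp_hom_def by simp
      moreover have "par \<gamma> a = Zero" "par \<gamma> b = Zero" using fixed par_Zero by metis+
      ultimately have "cls a = cls b" using mem col ab unfolding C_def inj_on_def by simp
      then have "orbital \<gamma> b = orbital \<gamma> a" using cls_eq psim_orbital[OF g] by blast
      then show False using orbital_fixed[OF g] fixed ab by simp
    qed
    show "C a = C b" if "b \<le> \<gamma> a \<or> \<gamma> b \<le> a"
    proof -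
      have "linked ?p a b \<or> linked ?p b a"
        using that ab restr_eq_Some[of \<gamma> A a "\<gamma> a"] restr_eq_Some[of \<gamma> A b "\<gamma> b"] unfolding linked_def by fastforce
      then have "prel ?p a b" using linked_prel[OF g] prel_commute by blast
      then have "cls a = cls b" using cls_eq prel_psim by blast
      then show ?thesis unfolding C_def by simp
    qed
  qed
  then obtain t where t: "strict_mono_on (A \<union> \<gamma> ` A) t" "\<And>a. a \<in> A \<Longrightarrow> t (\<gamma> a) = \<rho> (t a)" by blast
  have "finite (A \<union> \<gamma> ` A)" using A by simp
  then obtain \<tau> where \<tau>: "aut \<tau>" "\<forall>x\<in>A \<union> \<gamma> ` A. \<tau> x = t x"
    using extend_finite_strict_mono[OF _ t(1)] by blast
  \<comment> \<open>\<open>t\<close> leads from the points of \<gamma> to those of \<rho>, so the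
    conjugating automorphism is the inverse of its extension \<open>\<tau>\<close>.\<close>
  have "(inv \<tau> \<circ> \<rho> \<circ> inv (inv \<tau>)) a = \<gamma> a" if "a \<in> A" for a
    using that \<tau>(2) t(2)[OF that, symmetric] aut_inv_left[OF \<tau>(1), of "\<gamma> a"] aut_inv_inv[OF \<tau>(1)] by simp
  then show "\<exists>\<sigma>. aut \<sigma> \<and> (\<forall>a\<in>A. (\<sigma> \<circ> \<rho> \<circ> inv \<sigma>) a = \<gamma> a)"
    using aut_inv[OF \<tau>(1)] by blast
qed

theorem theorem3p1:
  fixes rho gamma :: "rat \<Rightarrow> rat"
  assumes "aut rho" and "aut gamma"
  shows "(gamma \<in> conj_closure rho \<longleftrightarrow>
            (\<forall>A. finite A \<longrightarrow> (\<exists>phi.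
               wp_hom (pclasses (restr gamma A) A) prec (pclcol (restr gamma A) A)
                      (orbitals rho) prec (orbcol rho) phi)))
       \<and> (gamma \<in> conj_closure rho \<longleftrightarrow>
            (type_inf3 prec (orbcol rho) (orbitals rho) \<or>
             (\<not> type_inf3 prec (orbcol gamma) (orbitals gamma) \<and>
              \<not> type_inf3 prec (orbcol rho) (orbitals rho) \<and>
              (\<exists>Dg cg Dr cr phi.
                 canonical_decomp (orbitals gamma) prec (orbcol gamma) Dg cg \<and>
                 canonical_decomp (orbitals rho) prec (orbcol rho) Dr cr \<and>
                 chi_hom Dg (setlt prec) cg Dr (setlt prec) cr phi))))"
proof -
  interpret G: strict_lin "orbitals gamma" prec by (rule strict_lin_orbitals[OF assms(2)])
  interpret R: strict_lin "orbitals rho" prec by (rule strict_lin_orbitals[OF assms(1)])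
  let ?hom = "fin_hom (orbitals gamma) prec (orbcol gamma) (orbitals rho) prec (orbcol rho)"
  let ?classes = "\<forall>A. finite A \<longrightarrow> (\<exists>phi.
      wp_hom (pclasses (restr gamma A) A) prec (pclcol (restr gamma A) A) (orbitals rho) prec (orbcol rho) phi)"
  have closure: "?hom" if "gamma \<in> conj_closure rho"
    by (rule fin_hom_of_conj_closure[OF assms that])
  have classes: "?classes" if ?hom
    using pclasses_wp_hom_of_fin_hom[OF assms _ that] by simp
  have conj: "gamma \<in> conj_closure rho" if "?classes"
    by (rule conj_closure_of_pclasses_wp_hom[OF assms that[rule_format]])
  have types: "?hom \<longleftrightarrow> type_inf3 prec (orbcol rho) (orbitals rho) \<or>
             (\<not> type_inf3 prec (orbcol gamma) (orbitals gamma) \<and>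
              \<not> type_inf3 prec (orbcol rho) (orbitals rho) \<and>
              (\<exists>Dg cg Dr cr phi.
                 canonical_decomp (orbitals gamma) prec (orbcol gamma) Dg cg \<and>
                 canonical_decomp (orbitals rho) prec (orbcol rho) Dr cr \<and>
                 chi_hom Dg (setlt prec) cg Dr (setlt prec) cr phi))" (is "_ \<longleftrightarrow> ?inf \<or> ?chi")
  proof
    assume hom: ?hom
    show "?inf \<or> ?chi"
    proof (cases ?inf)
      case False
      then have ninf: "\<not> type_inf3 prec (orbcol gamma) (orbitals gamma)"
        using G.inf3_of_fin_hom[OF hom R.strict_lin_axioms] by blast
      obtain Dg cg where Dg: "canonical_decomp (orbitals gamma) prec (orbcol gamma) Dg cg"
        using G.ex_canonical_decomp[OF ninf orbitals_Zero_dense[OF assms(2)]] by blast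
      obtain Dr cr where Dr: "canonical_decomp (orbitals rho) prec (orbcol rho) Dr cr"
        using R.ex_canonical_decomp[OF False orbitals_Zero_dense[OF assms(1)]] by blast
      have "\<exists>phi. chi_hom Dg (setlt prec) cg Dr (setlt prec) cr phi"
        by (rule chi_hom_of_fin_hom[OF G.strict_lin_axioms R.strict_lin_axioms hom
              Dg[unfolded canonical_decomp_def, THEN conjunct1] Dr[unfolded canonical_decomp_def, THEN conjunct1]])
      then show ?thesis using ninf False Dg Dr by blast
    qed blast
  next
    assume "?inf \<or> ?chi"
    then show ?hom
    proof
      assume ?inf
      then show ?hom by (rule G.fin_hom_of_inf3[OF R.strict_lin_axioms])
    next
      assume ?chi
      then obtain Dg cg Dr cr phi where Dg: "canonical_decomp (orbitals gamma) prec (orbcol gamma) Dg cg"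
        and Dr: "canonical_decomp (orbitals rho) prec (orbcol rho) Dr cr"
        and phi: "chi_hom Dg (setlt prec) cg Dr (setlt prec) cr phi" by blast
      show ?hom
        by (rule fin_hom_of_chi_hom[OF G.strict_lin_axioms R.strict_lin_axioms Dg
              Dr[unfolded canonical_decomp_def, THEN conjunct1] phi])
    qed
  qed
  have "gamma \<in> conj_closure rho \<longleftrightarrow> ?hom" "gamma \<in> conj_closure rho \<longleftrightarrow> ?classes"
    using closure classes conj by argo+
  then show ?thesis unfolding types by simp
qed

end
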